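(* Let $G$ be a finite group. Suppose that $G$ has a non-trivial $2$-maximal subgroup and that any $2$-maximal subgroup of $G$ is an $IC\Phi$-subgroup of $G$. Then $G$ is nilpotent.
   Context: All groups are finite. For a group $G$ and a subgroup $H \le G$, $[H,G]$ denotes the subgroup generated by all commutators $[h,g]$ with $h \in H$, $g \in G$, and $\Phi(H)$ denotes the Frattini subgroup of $H$ (the intersection of all maximal subgroups of $H$, with $\Phi(1)=1$). A subgroup $H$ of $G$ is an $IC\Phi$-subgroup of $G$ if $H \cap [H,G] \le \Phi(H)$. For a positive integer $n$, a subgroup $H$ of $G$ is $n$-maximal in $G$ if there is a chain of subgroups $H = H_0 < H_1 < \dots < H_n = G$, where $H_i$ is maximal in $H_{i+1}$ for all $0 \le i \le n-1$. *)

theory Defs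
  imports "HOL-Algebra.Algebra"
begin

(* [H, K], with the commutator convention h k h^-1 k^-1 of HOL-Algebra's derived_set.
   For subgroups H and K the convention h^-1 k^-1 h k generates the same subgroup. *)
definition commutator_subgroup ::
    "('a, 'b) monoid_scheme \<Rightarrow> 'a set \<Rightarrow> 'a set \<Rightarrow> 'a set" where
  "commutator_subgroup G H K =
     generate G (\<Union>h \<in> H. \<Union>k \<in> K. { h \<otimes>\<^bsub>G\<^esub> k \<otimes>\<^bsub>G\<^esub> inv\<^bsub>G\<^esub> h \<otimes>\<^bsub>G\<^esub> inv\<^bsub>G\<^esub> k })"

lemma derived_eq_commutator_subgroup: "derived G H = commutator_subgroup G H H"
  by (simp add: derived_def commutator_subgroup_def)

definition maximal_subgroup :: "'a set \<Rightarrow> ('a, 'b) monoid_scheme \<Rightarrow> bool" where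
  "maximal_subgroup M G \<longleftrightarrow>
     subgroup M G \<and> M \<noteq> carrier G \<and>
     (\<forall>K. subgroup K G \<longrightarrow> M \<subseteq> K \<longrightarrow> K = M \<or> K = carrier G)"

(* Intersecting with the carrier makes the empty intersection the whole group,
   so that the Frattini subgroup of the trivial group is trivial. *)
definition frattini :: "('a, 'b) monoid_scheme \<Rightarrow> 'a set" where
  "frattini G = carrier G \<inter> \<Inter> {M. maximal_subgroup M G}"

definition IC_Phi_subgroup :: "'a set \<Rightarrow> ('a, 'b) monoid_scheme \<Rightarrow> bool" where
  "IC_Phi_subgroup H G \<longleftrightarrow>
     subgroup H G \<and>
     H \<inter> commutator_subgroup G H (carrier G) \<subseteq> frattini (G\<lparr>carrier := H\<rparr>)"

definition n_maximal_subgroup :: "nat \<Rightarrow> 'a set \<Rightarrow> ('a, 'b) monoid_scheme \<Rightarrow> bool" where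
  "n_maximal_subgroup n H G \<longleftrightarrow>
     0 < n \<and>
     (\<exists>C :: nat \<Rightarrow> 'a set.
        C 0 = H \<and> C n = carrier G \<and> (\<forall>i \<le> n. subgroup (C i) G) \<and>
        (\<forall>i < n. maximal_subgroup (C i) (G\<lparr>carrier := C (Suc i)\<rparr>)))"

primrec lower_central :: "('a, 'b) monoid_scheme \<Rightarrow> nat \<Rightarrow> 'a set" where
  "lower_central G 0 = carrier G"
| "lower_central G (Suc i) = commutator_subgroup G (lower_central G i) (carrier G)"

definition nilpotent_group :: "('a, 'b) monoid_scheme \<Rightarrow> bool" where
  "nilpotent_group G \<longleftrightarrow> group G \<and> (\<exists>c. lower_central G c = {\<one>\<^bsub>G\<^esub>})"

end

theory Submission
  imports Defs
begin

text \<open>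
  Write \<open>R = [H, G]\<close> for a 2-maximal subgroup \<open>H \<noteq> 1\<close>. It is normal, \<open>H\<close> is not
  contained in it (as \<open>H \<inter> R \<le> \<Phi>(H) < H\<close>), and \<open>HR/R\<close> is central in \<open>G/R\<close>. This forces the maximal
  subgroups of \<open>G\<close> to be normal, without the structure theory of minimal non-nilpotent groups, and then
  the Frattini argument makes all Sylow subgroups normal.

  If no maximal subgroup were normal, every proper normal subgroup would lie in \<open>\<Phi>(G)\<close>; then \<open>\<Phi>(G)\<close>
  would be the only maximal subgroup of each maximal subgroup, and \<open>G\<close> would be a \<open>p\<close>-group, a
  contradiction. So some maximal subgroup \<open>K\<close> is normal. If \<open>M\<close> is a maximal subgroup that is not normal,
  then a subgroup \<open>A\<close> with \<open>[A, G] \<le> M\<close> normalizes \<open>M\<close> and so lies in \<open>M\<close>. This shows that \<open>K \<inter> M\<close> is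
  the unique maximal subgroup of \<open>K\<close>, so \<open>K\<close> is abelian. If \<open>K \<inter> M = 1\<close>, all 2-maximal subgroups are
  trivial. Otherwise, for each \<open>g\<close>, the endomorphism \<open>u \<mapsto> [u, g]\<close> of \<open>K\<close> is not surjective, since
  otherwise it would map \<open>K \<inter> M\<close> onto itself, giving \<open>K \<inter> M \<le> [K \<inter> M, G]\<close>; so \<open>[K, G] \<le> K \<inter> M\<close>, and hence \<open>K \<le> M\<close>, a contradiction.
\<close>

section \<open>Commutators modulo a normal subgroup\<close>

context group begin

lemma mult_inv_cancel:
  assumes "x \<in> carrier G" "y \<in> carrier G"
  shows "x \<otimes> (inv x \<otimes> y) = y" "inv x \<otimes> (x \<otimes> y) = y"
  using assms by (simp_all flip: m_assoc)

lemmas word_simps = m_assoc inv_mult_group mult_inv_cancel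

lemma card_eq_imp_carrier: "finite (carrier G) \<Longrightarrow> subgroup H G \<Longrightarrow> card H = order G \<Longrightarrow> H = carrier G"
  by (simp add: card_subset_eq order_def subgroup.subset)

text \<open>The full preimage in \<open>G\<close> of the centralizer of \<open>AN/N\<close> in \<open>G/N\<close>.\<close>

definition centralizer_mod :: "'a set \<Rightarrow> 'a set \<Rightarrow> 'a set" where
  "centralizer_mod A N = {x \<in> carrier G. \<forall>y\<in>A. x \<otimes> y \<otimes> inv x \<otimes> inv y \<in> N}"

lemma normal_conj_closed:
  assumes "N \<lhd> G" "x \<in> carrier G" "c \<in> N" 
  shows "x \<otimes> c \<otimes> inv x \<in> N" "inv x \<otimes> c \<otimes> x \<in> N"
  using assms normal_inv_iff[of N] inv_inv[of x] inv_closed[of x] by metis+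

lemma centralizer_mod_subgroup:
  assumes N: "N \<lhd> G" and A: "A \<subseteq> carrier G"
  shows "subgroup (centralizer_mod A N) G"
proof (rule subgroupI)
  have sN: "subgroup N G" using N by (simp add: normal_imp_subgroup)
  show "centralizer_mod A N \<subseteq> carrier G" by (auto simp: centralizer_mod_def)
  have "\<one> \<in> centralizer_mod A N"
    using A sN by (auto simp: centralizer_mod_def subset_iff subgroup.one_closed)
  then show "centralizer_mod A N \<noteq> {}" by blast
next
  have sN: "subgroup N G" using N by (simp add: normal_imp_subgroup)
  fix x assume x: "x \<in> centralizer_mod A N"
  show "inv x \<in> centralizer_mod A N"
    unfolding centralizer_mod_def
  proof (intro CollectI conjI ballI)
    fix y assume y: "y \<in> A"
    have c: "x \<in> carrier G" "y \<in> carrier G" using x y A by (auto simp: centralizer_mod_def)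
    \<comment> \<open>The identity behind closure under inverses: [x^-1, y] is the conjugate by x^-1
      of the inverse of [x, y].\<close>
    have "inv x \<otimes> inv (x \<otimes> y \<otimes> inv x \<otimes> inv y) \<otimes> x \<in> N"
      using normal_conj_closed(2)[OF N] x y sN by (auto simp: centralizer_mod_def subgroup.m_inv_closed)
    also have "inv x \<otimes> inv (x \<otimes> y \<otimes> inv x \<otimes> inv y) \<otimes> x = inv x \<otimes> y \<otimes> inv (inv x) \<otimes> inv y"
      using c by (simp add: word_simps)
    finally show "inv x \<otimes> y \<otimes> inv (inv x) \<otimes> inv y \<in> N" .
  qed (use x in \<open>auto simp: centralizer_mod_def\<close>)
next
  have sN: "subgroup N G" using N by (simp add: normal_imp_subgroup)
  fix x z assume x: "x \<in> centralizer_mod A N" and z: "z \<in> centralizer_mod A N"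
  show "x \<otimes> z \<in> centralizer_mod A N"
    unfolding centralizer_mod_def
  proof (intro CollectI conjI ballI)
    fix y assume y: "y \<in> A"
    have c: "x \<in> carrier G" "y \<in> carrier G" "z \<in> carrier G"
      using x y z A by (auto simp: centralizer_mod_def)
    \<comment> \<open>Closure under products comes from [xz, y] = x [z, y] x^-1 [x, y].\<close>
    have "(x \<otimes> (z \<otimes> y \<otimes> inv z \<otimes> inv y) \<otimes> inv x) \<otimes> (x \<otimes> y \<otimes> inv x \<otimes> inv y) \<in> N"
      by (rule subgroup.m_closed[OF sN normal_conj_closed(1)[OF N]])
        (use x y z in \<open>auto simp: centralizer_mod_def\<close>)
    also have "(x \<otimes> (z \<otimes> y \<otimes> inv z \<otimes> inv y) \<otimes> inv x) \<otimes> (x \<otimes> y \<otimes> inv x \<otimes> inv y)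
        = x \<otimes> z \<otimes> y \<otimes> inv (x \<otimes> z) \<otimes> inv y"
      using c by (simp add: word_simps)
    finally show "x \<otimes> z \<otimes> y \<otimes> inv (x \<otimes> z) \<otimes> inv y \<in> N" .
  qed (use x z in \<open>auto simp: centralizer_mod_def\<close>)
qed

text \<open>Centralizing modulo \<open>N\<close> is a symmetric relation, because [y, x] is the
  inverse of [x, y].\<close>

lemma centralizer_mod_commute:
  assumes N: "N \<lhd> G" and A: "A \<subseteq> carrier G" and B: "B \<subseteq> carrier G"
    and "B \<subseteq> centralizer_mod A N"
  shows "A \<subseteq> centralizer_mod B N"
  unfolding centralizer_mod_def
proof (intro subsetI CollectI conjI ballI)
  fix y x assume "y \<in> A" "x \<in> B"
  then have "inv (x \<otimes> y \<otimes> inv x \<otimes> inv y) \<in> N" "x \<in> carrier G" "y \<in> carrier G"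
    using assms normal_imp_subgroup[OF N] by (auto simp: centralizer_mod_def subgroup.m_inv_closed)
  then show "y \<otimes> x \<otimes> inv y \<otimes> inv x \<in> N" by (simp add: word_simps)
qed (use A in auto)

lemma centralizer_mod_normal:
  assumes N: "N \<lhd> G" and A: "A \<lhd> G"
  shows "centralizer_mod A N \<lhd> G"
  unfolding normal_inv_iff
proof (intro conjI ballI)
  have sA: "A \<subseteq> carrier G" using A by (simp add: normal_imp_subgroup subgroup.subset)
  show "subgroup (centralizer_mod A N) G" using centralizer_mod_subgroup N sA by blast
  fix g x assume g: "g \<in> carrier G" and x: "x \<in> centralizer_mod A N"
  show "g \<otimes> x \<otimes> inv g \<in> centralizer_mod A N"
    unfolding centralizer_mod_def
  proof (intro CollectI conjI ballI)
    fix y assume y: "y \<in> A"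
    have c: "x \<in> carrier G" "y \<in> carrier G" using x y sA by (auto simp: centralizer_mod_def)
    let ?y = "inv g \<otimes> y \<otimes> g"
    have "?y \<in> A" using normal_conj_closed(2)[OF A g y] .
    then have "g \<otimes> (x \<otimes> ?y \<otimes> inv x \<otimes> inv ?y) \<otimes> inv g \<in> N"
      using normal_conj_closed(1)[OF N g] x by (auto simp: centralizer_mod_def)
    also have "g \<otimes> (x \<otimes> ?y \<otimes> inv x \<otimes> inv ?y) \<otimes> inv g
       = (g \<otimes> x \<otimes> inv g) \<otimes> y \<otimes> inv (g \<otimes> x \<otimes> inv g) \<otimes> inv y"
      using c g by (simp add: word_simps)
    finally show "(g \<otimes> x \<otimes> inv g) \<otimes> y \<otimes> inv (g \<otimes> x \<otimes> inv g) \<otimes> inv y \<in> N" .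
  qed (use x g in \<open>auto simp: centralizer_mod_def\<close>)
qed

lemma normal_subset_centralizer_mod:
  assumes N: "N \<lhd> G" and A: "A \<subseteq> carrier G"
  shows "N \<subseteq> centralizer_mod A N"
proof
  have sN: "subgroup N G" using N by (simp add: normal_imp_subgroup)
  fix x assume x: "x \<in> N"
  show "x \<in> centralizer_mod A N"
    unfolding centralizer_mod_def
  proof (intro CollectI conjI ballI)
    show "x \<in> carrier G" using x sN by (auto simp: subgroup.mem_carrier)
    fix y assume y: "y \<in> A"
    have c: "x \<in> carrier G" "y \<in> carrier G" using x y A sN by (auto simp: subgroup.mem_carrier)
    have "x \<otimes> (y \<otimes> inv x \<otimes> inv y) \<in> N"
      by (rule subgroup.m_closed[OF sN x normal_conj_closed(1)[OF N]])
        (use x c sN in \<open>auto intro: subgroup.m_inv_closed\<close>)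
    then show "x \<otimes> y \<otimes> inv x \<otimes> inv y \<in> N" using c by (simp add: word_simps)
  qed
qed

section \<open>Commutator subgroups and normality\<close>

lemma commutator_subgroup_is_subgroup:
  assumes "H \<subseteq> carrier G" "K \<subseteq> carrier G"
  shows "subgroup (commutator_subgroup G H K) G"
  unfolding commutator_subgroup_def
  by (rule generate_is_subgroup) (use assms in \<open>auto simp: subset_iff\<close>)

text \<open>The bridge between generated commutator subgroups and elementwise conditions. With it,
  statements about central sections of G/N are handled without forming the quotient.\<close>

lemma commutator_subgroup_le_iff:
  assumes "H \<subseteq> carrier G" "subgroup N G"
  shows "commutator_subgroup G H K \<subseteq> N \<longleftrightarrow> H \<subseteq> centralizer_mod K N"
proof
  show "H \<subseteq> centralizer_mod K N" if "commutator_subgroup G H K \<subseteq> N"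
    using that assms unfolding commutator_subgroup_def centralizer_mod_def
    by (auto intro!: subsetD[OF that[unfolded commutator_subgroup_def]] generate.incl)
  show "commutator_subgroup G H K \<subseteq> N" if "H \<subseteq> centralizer_mod K N"
    unfolding commutator_subgroup_def
    by (rule generate_subgroup_incl) (use that assms in \<open>auto simp: centralizer_mod_def\<close>)
qed

lemma commutator_subgroup_mono:
  "H \<subseteq> H' \<Longrightarrow> K \<subseteq> K' \<Longrightarrow> commutator_subgroup G H K \<subseteq> commutator_subgroup G H' K'"
  unfolding commutator_subgroup_def by (rule mono_generate) auto

lemma commutator_subgroup_normal:
  assumes H: "subgroup H G"
  shows "commutator_subgroup G H (carrier G) \<lhd> G"
proof -
  let ?R = "commutator_subgroup G H (carrier G)"
  have Hc: "H \<subseteq> carrier G" using H by (rule subgroup.subset)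
  have sR: "subgroup ?R G" using Hc by (simp add: commutator_subgroup_is_subgroup)
  have HR: "h \<otimes> k \<otimes> inv h \<otimes> inv k \<in> ?R" if "h \<in> H" "k \<in> carrier G" for h k
    using that commutator_subgroup_le_iff[OF Hc sR, of "carrier G"]  by (auto simp: centralizer_mod_def)
  \<comment> \<open>\<open>N\<close> collects the elements all of whose conjugates lie in
    \<open>?R\<close>. Once it is a subgroup containing every generator [h, k], the inclusion of
    \<open>?R\<close> in \<open>N\<close> is the claimed normality.\<close>
  define N where "N = {x \<in> carrier G. \<forall>g\<in>carrier G. g \<otimes> x \<otimes> inv g \<in> ?R}"
  have "subgroup N G"
  proof (rule subgroupI)
    show "N \<subseteq> carrier G" by (auto simp: N_def)
    have "\<one> \<in> N" using sR by (auto simp: N_def subgroup.one_closed)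
    then show "N \<noteq> {}" by blast
    show "inv x \<in> N" if "x \<in> N" for x
    proof -
      have "inv (g \<otimes> x \<otimes> inv g) \<in> ?R" if "g \<in> carrier G" for g
        using that \<open>x \<in> N\<close> sR by (auto simp: N_def subgroup.m_inv_closed)
      then show ?thesis using \<open>x \<in> N\<close> by (auto simp: N_def word_simps)
    qed
    show "x \<otimes> y \<in> N" if "x \<in> N" "y \<in> N" for x y
    proof -
      have "(g \<otimes> x \<otimes> inv g) \<otimes> (g \<otimes> y \<otimes> inv g) \<in> ?R" if "g \<in> carrier G" for g
        by (rule subgroup.m_closed[OF sR]) (use that \<open>x \<in> N\<close> \<open>y \<in> N\<close> in \<open>auto simp: N_def\<close>)
      then show ?thesis using that by (auto simp: N_def word_simps)
    qed
  qed
  moreover have "h \<otimes> k \<otimes> inv h \<otimes> inv k \<in> N" if h: "h \<in> H" and k: "k \<in> carrier G" for h k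
    unfolding N_def
  proof (intro CollectI conjI ballI)
    have hc: "h \<in> carrier G" using h Hc by auto
    then show "h \<otimes> k \<otimes> inv h \<otimes> inv k \<in> carrier G" using k by simp
    fix g assume g: "g \<in> carrier G"
    \<comment> \<open>A conjugate of a generator is expressed through generators: [h, g]^-1 [h, gk]
      = g [h, k] g^-1.\<close>
    have "inv (h \<otimes> g \<otimes> inv h \<otimes> inv g) \<otimes> (h \<otimes> (g \<otimes> k) \<otimes> inv h \<otimes> inv (g \<otimes> k)) \<in> ?R"
      by (rule subgroup.m_closed[OF sR subgroup.m_inv_closed[OF sR]]; rule HR) (use h k g in auto)
    also have "inv (h \<otimes> g \<otimes> inv h \<otimes> inv g) \<otimes> (h \<otimes> (g \<otimes> k) \<otimes> inv h \<otimes> inv (g \<otimes> k))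
      = g \<otimes> (h \<otimes> k \<otimes> inv h \<otimes> inv k) \<otimes> inv g"
      using hc k g by (simp add: word_simps)
    finally show "g \<otimes> (h \<otimes> k \<otimes> inv h \<otimes> inv k) \<otimes> inv g \<in> ?R" .
  qed
  ultimately have "?R \<subseteq> N"
    unfolding commutator_subgroup_def by (intro generate_subgroup_incl) auto
  then show ?thesis unfolding normal_inv_iff using sR by (auto simp: N_def)
qed

text \<open>Each conjugate differs from the element by a commutator: g h g^-1 = [h, g]^-1 h.\<close>

lemma normal_of_commutator_le:
  assumes "subgroup H G" "commutator_subgroup G H (carrier G) \<subseteq> H"
  shows "H \<lhd> G"
  unfolding normal_inv_iff
proof (intro conjI ballI)
  show "subgroup H G" by fact
  fix g h assume g: "g \<in> carrier G" and h: "h \<in> H"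
  have hc: "h \<in> carrier G" using assms h by (simp add: subgroup.mem_carrier)
  have "h \<otimes> g \<otimes> inv h \<otimes> inv g \<in> H"
    using assms commutator_subgroup_le_iff[of H H "carrier G"] g h
    by (auto simp: centralizer_mod_def subgroup.subset)
  then have "inv (h \<otimes> g \<otimes> inv h \<otimes> inv g) \<otimes> h \<in> H"
    using subgroup.m_closed[OF assms(1) subgroup.m_inv_closed[OF assms(1)]] h by blast
  then show "g \<otimes> h \<otimes> inv g \<in> H" using g hc by (simp add: word_simps)
qed

lemma commutator_le_normal:
  assumes "H \<lhd> G" shows "commutator_subgroup G H (carrier G) \<subseteq> H"
  using assms normal_subset_centralizer_mod[OF assms, of "carrier G"] commutator_subgroup_le_iff
  by (simp add: normal_imp_subgroup subgroup.subset)

section \<open>Passing to a subgroup as the ambient group\<close>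

lemma subgroup_carrier_update_iff:
  assumes "subgroup K G"
  shows "subgroup H (G\<lparr>carrier := K\<rparr>) \<longleftrightarrow> subgroup H G \<and> H \<subseteq> K"

proof
  show "subgroup H G \<and> H \<subseteq> K" if "subgroup H (G\<lparr>carrier := K\<rparr>)"
    using incl_subgroup[OF assms that] subgroup.subset[OF that] by simp
  show "subgroup H (G\<lparr>carrier := K\<rparr>)" if "subgroup H G \<and> H \<subseteq> K"
    using subgroup_incl[OF _ assms] that by blast
qed

lemma maximal_subgroup_carrier_update_iff:
  assumes "subgroup K G"
  shows "maximal_subgroup M (G\<lparr>carrier := K\<rparr>) \<longleftrightarrow>
    subgroup M G \<and> M \<subset> K \<and> (\<forall>L. subgroup L G \<longrightarrow> M \<subseteq> L \<longrightarrow> L \<subseteq> K \<longrightarrow> L = M \<or> L = K)"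
  unfolding maximal_subgroup_def subgroup_carrier_update_iff[OF assms] by auto

lemma commutator_subgroup_carrier_update:
  assumes K: "subgroup K G" and "H \<subseteq> K" "L \<subseteq> K"
  shows "commutator_subgroup (G\<lparr>carrier := K\<rparr>) H L = commutator_subgroup G H L"
proof -
  have "(\<Union>h\<in>H. \<Union>k\<in>L. {h \<otimes> k \<otimes> inv\<^bsub>G\<lparr>carrier := K\<rparr>\<^esub> h \<otimes> inv\<^bsub>G\<lparr>carrier := K\<rparr>\<^esub> k})
      = (\<Union>h\<in>H. \<Union>k\<in>L. {h \<otimes> k \<otimes> inv h \<otimes> inv k})"
    by (intro SUP_cong refl) (use assms m_inv_consistent[OF K] in \<open>auto simp: subset_iff\<close>)
  moreover have "(\<Union>h\<in>H. \<Union>k\<in>L. {h \<otimes> k \<otimes> inv h \<otimes> inv k}) \<subseteq> K"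
    using assms by (auto simp: subset_iff subgroup.m_closed[OF K] subgroup.m_inv_closed[OF K])
  ultimately show ?thesis
    unfolding commutator_subgroup_def using generate_consistent[OF _ K] by simp
qed

end

section \<open>Maximal subgroups and the Frattini subgroup\<close>

lemma two_maximal_subgroup_iff:
  assumes "group G"
  shows "n_maximal_subgroup 2 H G \<longleftrightarrow>
    (\<exists>M. maximal_subgroup M G \<and> maximal_subgroup H (G\<lparr>carrier := M\<rparr>))"
proof
  interpret group G by fact
  assume "n_maximal_subgroup 2 H G"
  then obtain C where C: "C 0 = H" "C 2 = carrier G" 
    "\<And>i. i < 2 \<Longrightarrow> maximal_subgroup (C i) (G\<lparr>carrier := C (Suc i)\<rparr>)"
    unfolding n_maximal_subgroup_def by (metis (no_types))
  have "maximal_subgroup H (G\<lparr>carrier := C 1\<rparr>)" "maximal_subgroup (C 1) G"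
    using C(3)[of 0] C(3)[of 1] C(1,2) by (simp_all add: numeral_2_eq_2)
  then show "\<exists>M. maximal_subgroup M G \<and> maximal_subgroup H (G\<lparr>carrier := M\<rparr>)" by blast
next
  interpret group G by fact
  assume "\<exists>M. maximal_subgroup M G \<and> maximal_subgroup H (G\<lparr>carrier := M\<rparr>)"
  then obtain M where M: "maximal_subgroup M G" "maximal_subgroup H (G\<lparr>carrier := M\<rparr>)" by blast
  then have s: "subgroup M G" "subgroup H G"
    using maximal_subgroup_carrier_update_iff[of M H] by (auto simp: maximal_subgroup_def)
  show "n_maximal_subgroup 2 H G"
    unfolding n_maximal_subgroup_def
    by (intro conjI exI[of _ "\<lambda>i. if i = 0 then H else if i = 1 then M else carrier G"])
      (use M s subgroup_self in \<open>auto simp: less_2_cases_iff\<close>)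
qed

context group begin

section \<open>Existence of maximal subgroups, products, normalizers and conjugates\<close>

lemma maximal_subgroup_exists:
  assumes fin: "finite (carrier G)" and H: "subgroup H G" "H \<noteq> carrier G"
  shows "\<exists>M. maximal_subgroup M G \<and> H \<subseteq> M"
proof -
  let ?S = "{K. subgroup K G \<and> K \<noteq> carrier G}"
  have "finite ?S"
    by (rule finite_subset[of _ "Pow (carrier G)"]) (use fin in \<open>auto dest: subgroup.subset\<close>)
  from finite_has_maximal2[OF this, of H] H
  obtain M where "M \<in> ?S" "H \<subseteq> M" "\<And>b. b \<in> ?S \<Longrightarrow> M \<subseteq> b \<Longrightarrow> M = b" by auto
  then show ?thesis unfolding maximal_subgroup_def by blast
qed

lemma maximal_subgroup_in_exists:
  assumes fin: "finite (carrier G)" and "subgroup K G" "subgroup H G" "H \<subset> K"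
  shows "\<exists>M. maximal_subgroup M (G\<lparr>carrier := K\<rparr>) \<and> H \<subseteq> M"
proof -
  interpret K: group "G\<lparr>carrier := K\<rparr>" using assms(2) by (rule subgroup_imp_group)
  show ?thesis
    using K.maximal_subgroup_exists[of H] assms subgroup_carrier_update_iff[of K H]
      finite_subset[OF subgroup.subset[OF assms(2)] fin] by auto
qed

lemma subset_set_mult:
  assumes "subgroup N G" "subgroup H G"
  shows "N \<subseteq> N <#> H" "H \<subseteq> N <#> H"
proof -
  have "n \<otimes> \<one> \<in> N <#> H" if "n \<in> N" for n
    using that subgroup.one_closed[OF assms(2)] unfolding set_mult_def by blast
  then show "N \<subseteq> N <#> H" using assms(1) by (auto simp: subgroup.mem_carrier)
  have "\<one> \<otimes> h \<in> N <#> H" if "h \<in> H" for h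
    using that subgroup.one_closed[OF assms(1)] unfolding set_mult_def by blast
  then show "H \<subseteq> N <#> H" using assms(2) by (auto simp: subgroup.mem_carrier)
qed

lemma set_mult_least:
  assumes "subgroup K G" "N \<subseteq> K" "H \<subseteq> K"
  shows "N <#> H \<subseteq> K"
  using assms by (auto simp: set_mult_def subset_iff subgroup.m_closed)

lemma maximal_subgroup_set_mult:
  assumes "N \<lhd> G" "maximal_subgroup M G" "\<not> N \<subseteq> M"
  shows "N <#> M = carrier G"
proof -
  have "subgroup M G" "subgroup N G" using assms by (auto simp: maximal_subgroup_def normal_imp_subgroup)
  then show ?thesis
    using assms subset_set_mult[of N M] mult_norm_subgroup[of N M]
    unfolding maximal_subgroup_def by (metis)
qed

lemma maximal_subgroup_in_set_mult:
  assumes "N \<lhd> G" "subgroup K G" "N \<subseteq> K" "maximal_subgroup M (G\<lparr>carrier := K\<rparr>)" "\<not> N \<subseteq> M"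
  shows "N <#> M = K"
proof -
  have M: "subgroup M G" "M \<subset> K" 
    and *: "\<And>L. subgroup L G \<Longrightarrow> M \<subseteq> L \<Longrightarrow> L \<subseteq> K \<Longrightarrow> L = M \<or> L = K"
    using assms(4) maximal_subgroup_carrier_update_iff[OF assms(2)] by auto
  have N: "subgroup N G" using assms by (simp add: normal_imp_subgroup)
  have "N <#> M \<subseteq> K" using set_mult_least assms M by blast
  then show ?thesis using *[of "N <#> M"] subset_set_mult[OF N M(1)] mult_norm_subgroup[OF assms(1) M(1)] assms(5)
    by blast
qed

text \<open>The defining condition asks only for an inclusion of the conjugate in \<open>M\<close>.
  As \<open>M\<close> is finite and conjugation is injective, the inclusion is an equality, which
  gives closure under inverses.\<close>

lemma finite_normalizer_subgroup:
  assumes sM: "subgroup M G" and fin: "finite M"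
  shows "subgroup {g \<in> carrier G. \<forall>m\<in>M. g \<otimes> m \<otimes> inv g \<in> M} G" (is "subgroup ?Z G")
proof (rule subgroupI)
  have Mc: "m \<in> carrier G" if "m \<in> M" for m using that sM by (simp add: subgroup.mem_carrier)
  show "?Z \<subseteq> carrier G" by auto
  have "\<one> \<in> ?Z" by (auto simp: Mc)
  then show "?Z \<noteq> {}" by blast
  fix g assume g: "g \<in> ?Z"
  have "inj_on (\<lambda>m. g \<otimes> m \<otimes> inv g) M" using g Mc by (auto simp: inj_on_def)
  then have surj: "(\<lambda>m. g \<otimes> m \<otimes> inv g) ` M = M"
    using g by (intro endo_inj_surj[OF fin]) auto
  have "inv g \<otimes> m \<otimes> g \<in> M" if m: "m \<in> M" for m
  proof -
    obtain m' where "m' \<in> M" "m = g \<otimes> m' \<otimes> inv g" using surj m by blast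
    then show ?thesis using g Mc by (simp add: word_simps)
  qed
  then show "inv g \<in> ?Z" using g by auto
  fix h assume h: "h \<in> ?Z"
  have "g \<otimes> (h \<otimes> m \<otimes> inv h) \<otimes> inv g \<in> M" if "m \<in> M" for m
    using that g h by auto
  then show "g \<otimes> h \<in> ?Z" using g h by (auto simp: word_simps Mc)
qed

text \<open>A single normalizing element outside \<open>M\<close> suffices: the normalizer then
  properly contains the maximal subgroup \<open>M\<close>, so it is the whole group.\<close>

lemma maximal_subgroup_normalI:
  assumes fin: "finite (carrier G)" and M: "maximal_subgroup M G"
    and a: "a \<in> carrier G" "a \<notin> M" "\<And>m. m \<in> M \<Longrightarrow> a \<otimes> m \<otimes> inv a \<in> M"
  shows "M \<lhd> G"
proof -
  have sM: "subgroup M G" using M by (simp add: maximal_subgroup_def)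
  let ?Z = "{g \<in> carrier G. \<forall>m\<in>M. g \<otimes> m \<otimes> inv g \<in> M}"
  have "M \<subseteq> ?Z" using sM
    by (auto simp: subgroup.mem_carrier subgroup.m_closed subgroup.m_inv_closed)
  moreover have "subgroup ?Z G"
    using finite_normalizer_subgroup[OF sM] finite_subset[OF subgroup.subset[OF sM] fin] by blast
  ultimately have "?Z = carrier G" using M a unfolding maximal_subgroup_def by blast
  then show ?thesis using sM unfolding normal_inv_iff by blast
qed

text \<open>For a in \<open>A\<close> and m in \<open>M\<close>, a m a^-1 = [a, m] m lies in
  \<open>M\<close>. Hence all of \<open>A\<close> normalizes \<open>M\<close>, and an element of
  \<open>A\<close> outside \<open>M\<close> would make \<open>M\<close> normal.\<close>

lemma maximal_subgroup_normal_or_le: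
  assumes fin: "finite (carrier G)" and M: "maximal_subgroup M G" and A: "subgroup A G"
    and AM: "commutator_subgroup G A (carrier G) \<subseteq> M"
  shows "M \<lhd> G \<or> A \<subseteq> M"
proof (rule disjCI)
  assume "\<not> A \<subseteq> M"
  then obtain a where a: "a \<in> A" "a \<notin> M" by blast
  have sM: "subgroup M G" using M by (simp add: maximal_subgroup_def)
  have ac: "a \<in> carrier G" using a A by (simp add: subgroup.mem_carrier)
  show "M \<lhd> G"
  proof (rule maximal_subgroup_normalI[OF fin M ac a(2)])
    fix m assume m: "m \<in> M"
    have mc: "m \<in> carrier G" using m sM by (auto simp: subgroup.mem_carrier)
    have "A \<subseteq> centralizer_mod (carrier G) M"
      using AM commutator_subgroup_le_iff[OF subgroup.subset[OF A] sM] by blast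
    then have "a \<otimes> m \<otimes> inv a \<otimes> inv m \<in> M" using a mc by (auto simp: centralizer_mod_def)
    from subgroup.m_closed[OF sM this m] show "a \<otimes> m \<otimes> inv a \<in> M"
      using ac mc by (simp add: word_simps)
  qed
qed

lemma conj_vimage_subgroup:
  assumes "subgroup M G" "g \<in> carrier G"
  shows "subgroup {x \<in> carrier G. g \<otimes> x \<otimes> inv g \<in> M} G"
proof (rule subgroupI)
  have "\<one> \<in> {x \<in> carrier G. g \<otimes> x \<otimes> inv g \<in> M}" using assms by (simp add: subgroup.one_closed)
  then show "{x \<in> carrier G. g \<otimes> x \<otimes> inv g \<in> M} \<noteq> {}" by blast
  fix x assume x: "x \<in> {x \<in> carrier G. g \<otimes> x \<otimes> inv g \<in> M}"
  then have "inv (g \<otimes> x \<otimes> inv g) \<in> M" using assms by (simp add: subgroup.m_inv_closed)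
  then show "inv x \<in> {x \<in> carrier G. g \<otimes> x \<otimes> inv g \<in> M}" using x assms(2) by (simp add: word_simps)
  fix y assume y: "y \<in> {x \<in> carrier G. g \<otimes> x \<otimes> inv g \<in> M}"
  have "(g \<otimes> x \<otimes> inv g) \<otimes> (g \<otimes> y \<otimes> inv g) \<in> M"
    by (rule subgroup.m_closed[OF assms(1)]) (use x y in auto)
  then show "x \<otimes> y \<in> {x \<in> carrier G. g \<otimes> x \<otimes> inv g \<in> M}" using x y assms(2) by (simp add: word_simps)
qed auto

text \<open>Conjugation by \<open>g\<close> restricts to an automorphism of the normal subgroup
  \<open>J\<close>, so it permutes the maximal subgroups of \<open>J\<close>. This is what makes
  \<Phi>(J) normal in \<open>G\<close>.\<close>

lemma conj_vimage_maximal: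
  assumes J: "J \<lhd> G" and M: "maximal_subgroup M (G\<lparr>carrier := J\<rparr>)" and g: "g \<in> carrier G"
  shows "maximal_subgroup {x \<in> carrier G. g \<otimes> x \<otimes> inv g \<in> M} (G\<lparr>carrier := J\<rparr>)"
proof -
  let ?M = "{x \<in> carrier G. g \<otimes> x \<otimes> inv g \<in> M}"
  have sJ: "subgroup J G" using J by (simp add: normal_imp_subgroup)
  note iff = maximal_subgroup_carrier_update_iff[OF sJ]
  have sM: "subgroup M G" and MJ: "M \<subset> J"
    and *: "\<And>L. subgroup L G \<Longrightarrow> M \<subseteq> L \<Longrightarrow> L \<subseteq> J \<Longrightarrow> L = M \<or> L = J"
    using M iff by auto
  have Jc: "J \<subseteq> carrier G" using sJ by (rule subgroup.subset)
  have Mc: "M \<subseteq> carrier G" using sM by (rule subgroup.subset)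
  have J1: "x \<in> J" if "x \<in> carrier G" "g \<otimes> x \<otimes> inv g \<in> J" for x
    using normal_conj_closed(2)[OF J g that(2)] that g by (simp add: word_simps)
  have J2: "g \<otimes> x \<otimes> inv g \<in> J" if "x \<in> J" for x
    using normal_conj_closed(1)[OF J g that] .
  have J3: "inv g \<otimes> x \<otimes> g \<in> J" if "x \<in> J" for x
    using normal_conj_closed(2)[OF J g that] .
  show ?thesis unfolding iff
  proof (intro conjI allI impI)
    show "subgroup ?M G" using sM g by (rule conj_vimage_subgroup)
    have "?M \<subseteq> J" using J1 MJ by auto
    moreover obtain y where y: "y \<in> J" "y \<notin> M" using MJ by blast
    then have "inv g \<otimes> y \<otimes> g \<notin> ?M" using g Jc by (auto simp: word_simps subset_iff)
    ultimately show "?M \<subset> J" using J3[OF y(1)] by blast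
    fix L assume L: "subgroup L G" "?M \<subseteq> L" "L \<subseteq> J"
    \<comment> \<open>The intermediate subgroup \<open>L\<close> is carried back by the inverse
      conjugation to a subgroup between \<open>M\<close> and \<open>J\<close>, where maximality of
      \<open>M\<close> applies.\<close>
    let ?L = "{x \<in> carrier G. inv g \<otimes> x \<otimes> inv (inv g) \<in> L}"
    have Lc: "L \<subseteq> carrier G" using L(1) by (rule subgroup.subset)
    have sL: "subgroup ?L G" using conj_vimage_subgroup[OF L(1)] g by blast
    have "M \<subseteq> ?L"
    proof
      fix x assume x: "x \<in> M"
      then have xc: "x \<in> carrier G" using Mc by blast
      then have "inv g \<otimes> x \<otimes> g \<in> ?M" using g x by (simp add: word_simps)
      then show "x \<in> ?L" using L(2) xc g by auto
    qed
    moreover have "?L \<subseteq> J"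
    proof
      fix x assume x: "x \<in> ?L"
      then have "g \<otimes> (inv g \<otimes> x \<otimes> g) \<otimes> inv g \<in> J" using L(3) g by (intro J2) auto
      then show "x \<in> J" using x g by (simp add: word_simps)
    qed
    ultimately have "?L = M \<or> ?L = J" using * sL by blast
    moreover have "x \<in> L \<longleftrightarrow> g \<otimes> x \<otimes> inv g \<in> ?L" if "x \<in> carrier G" for x
      using that g by (simp add: word_simps)
    ultimately have "(\<forall>x\<in>carrier G. x \<in> L \<longleftrightarrow> g \<otimes> x \<otimes> inv g \<in> M) \<or>
        (\<forall>x\<in>carrier G. x \<in> L \<longleftrightarrow> g \<otimes> x \<otimes> inv g \<in> J)" by blast
    then show "L = ?M \<or> L = J"
    proof
      assume "\<forall>x\<in>carrier G. x \<in> L \<longleftrightarrow> g \<otimes> x \<otimes> inv g \<in> M"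
      then show ?thesis using Lc by blast
    next
      assume "\<forall>x\<in>carrier G. x \<in> L \<longleftrightarrow> g \<otimes> x \<otimes> inv g \<in> J"
      then have "L = J" using Lc Jc J1 J2 by blast
      then show ?thesis by blast
    qed
  qed
qed

section \<open>The Frattini subgroup\<close>

lemma frattini_subset: "frattini G \<subseteq> carrier G"
  by (auto simp: frattini_def)

lemma frattini_le_maximal: "maximal_subgroup M G \<Longrightarrow> frattini G \<subseteq> M"
  by (auto simp: frattini_def)

lemma frattini_subgroup: "subgroup (frattini G) G"
proof -
  have "frattini G = \<Inter> (insert (carrier G) {M. maximal_subgroup M G})"
    by (auto simp: frattini_def)
  also have "subgroup \<dots> G"
    by (rule subgroups_Inter) (auto simp: subgroup_self maximal_subgroup_def)
  finally show ?thesis .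
qed

lemma frattini_proper:
  assumes "finite (carrier G)" "carrier G \<noteq> {\<one>}"
  shows "frattini G \<noteq> carrier G"
proof -
  obtain M where "maximal_subgroup M G"
    using maximal_subgroup_exists[OF assms(1) triv_subgroup] assms(2) by blast
  then show ?thesis using frattini_le_maximal[of M] subgroup.subset[of M G]
    by (auto simp: maximal_subgroup_def)
qed

lemma frattini_of_normal_is_normal:
  assumes J: "J \<lhd> G"
  shows "frattini (G\<lparr>carrier := J\<rparr>) \<lhd> G"
proof (rule normal_invI)
  have sJ: "subgroup J G" using J by (simp add: normal_imp_subgroup)
  interpret J: group "G\<lparr>carrier := J\<rparr>" using sJ by (rule subgroup_imp_group)
  show "subgroup (frattini (G\<lparr>carrier := J\<rparr>)) G"
    using incl_subgroup[OF sJ J.frattini_subgroup] .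
  fix g x assume g: "g \<in> carrier G" and x: "x \<in> frattini (G\<lparr>carrier := J\<rparr>)"
  then have "g \<otimes> x \<otimes> inv g \<in> M" if "maximal_subgroup M (G\<lparr>carrier := J\<rparr>)" for M
    using conj_vimage_maximal[OF J that g] by (auto simp: frattini_def)
  moreover have "g \<otimes> x \<otimes> inv g \<in> J"
    using normal_conj_closed(1)[OF J g] x by (auto simp: frattini_def)
  ultimately show "g \<otimes> x \<otimes> inv g \<in> frattini (G\<lparr>carrier := J\<rparr>)"
    by (auto simp: frattini_def)
qed

lemma frattini_normal: "frattini G \<lhd> G"
  using frattini_of_normal_is_normal[OF normal_self] by simp

text \<open>If a maximal subgroup M of G missed F = \<Phi>(J), then FM = G, and the modular law
  would give J = F(J \<inter> M). But J \<inter> M is proper in J, so it lies in a maximal subgroup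
  of J, which contains F as well and would thus be all of J.\<close>

lemma frattini_of_normal_mono:
  assumes fin: "finite (carrier G)" and J: "J \<lhd> G"
  shows "frattini (G\<lparr>carrier := J\<rparr>) \<subseteq> frattini G"
proof -
  let ?F = "frattini (G\<lparr>carrier := J\<rparr>)"
  have sJ: "subgroup J G" using J by (simp add: normal_imp_subgroup)
  interpret J: group "G\<lparr>carrier := J\<rparr>" using sJ by (rule subgroup_imp_group)
  have FJ: "?F \<subseteq> J" using J.frattini_subset by simp
  have F: "?F \<lhd> G" using J by (rule frattini_of_normal_is_normal)
  have sF: "subgroup ?F G" using F by (rule normal_imp_subgroup)
  have "?F \<subseteq> M" if M: "maximal_subgroup M G" for M
  proof (rule ccontr)
    assume not: "\<not> ?F \<subseteq> M"
    have sM: "subgroup M G" using M by (simp add: maximal_subgroup_def)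
    have FM: "?F <#> M = carrier G" using maximal_subgroup_set_mult[OF F M not] .
    have "J \<inter> M \<subset> J" using not FJ by blast
    then obtain L where L: "maximal_subgroup L (G\<lparr>carrier := J\<rparr>)" "J \<inter> M \<subseteq> L"
      using maximal_subgroup_in_exists[OF fin sJ] subgroups_Inter_pair[OF sJ sM] by blast
    have sL: "subgroup L G" "L \<subset> J" using L maximal_subgroup_carrier_update_iff[OF sJ] by auto
    have FL: "?F \<subseteq> L" using J.frattini_le_maximal[OF L(1)] .
    \<comment> \<open>The modular law, elementwise: in x = f m both x and f lie in \<open>J\<close>,
      so m lies in \<open>J\<close> and \<open>M\<close>, and thus in \<open>L\<close>.\<close>
    have "J \<subseteq> L"
    proof
      fix x assume x: "x \<in> J"
      then have "x \<in> ?F <#> M" using FM subgroup.subset[OF sJ] by blast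
      then obtain f m where fm: "f \<in> ?F" "m \<in> M" "x = f \<otimes> m" by (auto simp: set_mult_def)
      have c: "f \<in> carrier G" "m \<in> carrier G"
        using fm sF sM by (auto simp: subgroup.mem_carrier)
      have "inv f \<otimes> x \<in> J" using fm FJ x by (intro subgroup.m_closed[OF sJ] subgroup.m_inv_closed[OF sJ]) auto
      then have "m \<in> J" using fm c by (simp add: word_simps)
      then show "x \<in> L" using fm L FL by (auto intro: subgroup.m_closed[OF sL(1)])
    qed
    then show False using sL by blast
  qed
  then show ?thesis using subgroup.subset[OF sF] by (auto simp: frattini_def[of G])
qed

section \<open>Consequences of the IC\<Phi> condition\<close>

lemma IC_Phi_not_le_commutator:
  assumes "finite (carrier G)" "IC_Phi_subgroup H G" "H \<noteq> {\<one>}"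
  shows "\<not> H \<subseteq> commutator_subgroup G H (carrier G)"
proof
  assume "H \<subseteq> commutator_subgroup G H (carrier G)"
  then have *: "H \<subseteq> frattini (G\<lparr>carrier := H\<rparr>)" and sH: "subgroup H G"
    using assms(2) by (auto simp: IC_Phi_subgroup_def)
  interpret H: group "G\<lparr>carrier := H\<rparr>" using sH by (rule subgroup_imp_group)
  show False using H.frattini_proper H.frattini_subset * assms finite_subset[OF subgroup.subset[OF sH]]
    by auto
qed

text \<open>For normal \<open>H\<close> the intersection in the IC\<Phi> condition is [H, G] itself,
  so [H, G] \<le> \<Phi>(H) \<le> \<Phi>(G).\<close>

lemma normal_IC_Phi_commutator_le:
  assumes "finite (carrier G)" "IC_Phi_subgroup H G" "H \<lhd> G"
  shows "commutator_subgroup G H (carrier G) \<subseteq> frattini G"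
  using assms(2) commutator_le_normal[OF assms(3)] frattini_of_normal_mono[OF assms(1,3)]
  by (auto simp: IC_Phi_subgroup_def)

text \<open>Both \<open>R\<close> and \<open>H\<close> centralize \<open>G\<close> modulo
  \<open>R\<close>, and hence so does their product: RH/R is central in G/R.\<close>

lemma commutator_le_of_set_mult:
  assumes H: "subgroup H G"
  defines "R \<equiv> commutator_subgroup G H (carrier G)"
  shows "commutator_subgroup G (R <#> H) (carrier G) \<subseteq> R"
proof -
  have R: "R \<lhd> G" unfolding R_def using H by (rule commutator_subgroup_normal)
  have sR: "subgroup R G" using R by (rule normal_imp_subgroup)
  have sZ: "subgroup (centralizer_mod (carrier G) R) G" using centralizer_mod_subgroup[OF R] by blast
  have "R \<subseteq> centralizer_mod (carrier G) R" using normal_subset_centralizer_mod[OF R] by blast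
  moreover have "H \<subseteq> centralizer_mod (carrier G) R"
    using commutator_subgroup_le_iff[OF subgroup.subset[OF H] sR, of "carrier G"] by (simp add: R_def)
  ultimately have "R <#> H \<subseteq> centralizer_mod (carrier G) R" using set_mult_least[OF sZ] by blast
  then show ?thesis
    using commutator_subgroup_le_iff[OF subgroup.subset[OF mult_norm_subgroup[OF R H]] sR] by blast
qed

text \<open>The analogue for maximal in place of 2-maximal subgroups; it is later applied inside
  each maximal subgroup of the original group. If H is not normal, R = [H, G] satisfies RH = G, so
  G/R is abelian. As R is proper, some maximal K contains R and is normal; then [K, G] \<le>
  \<Phi>(G) \<le> H forces K \<le> H, although R is not contained in H.\<close>

lemma IC_Phi_maximal_normal:
  assumes fin: "finite (carrier G)"
    and IC: "\<And>M. maximal_subgroup M G \<Longrightarrow> IC_Phi_subgroup M G"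
    and H: "maximal_subgroup H G"
  shows "H \<lhd> G"
proof (rule ccontr)
  assume not: "\<not> H \<lhd> G"
  let ?R = "commutator_subgroup G H (carrier G)"
  have sH: "subgroup H G" using H by (simp add: maximal_subgroup_def)
  have R: "?R \<lhd> G" using commutator_subgroup_normal[OF sH] .
  have sR: "subgroup ?R G" using R by (rule normal_imp_subgroup)
  have "H \<noteq> {\<one>}" using not one_is_normal by blast
  have "\<not> ?R \<subseteq> H" using not normal_of_commutator_le[OF sH] by blast
  then have "?R <#> H = carrier G" using maximal_subgroup_set_mult[OF R H] by blast
  then have GR: "commutator_subgroup G (carrier G) (carrier G) \<subseteq> ?R"
    using commutator_le_of_set_mult[OF sH] by simp
  have "?R \<noteq> carrier G"
    using IC_Phi_not_le_commutator[OF fin IC[OF H] \<open>H \<noteq> {\<one>}\<close>] subgroup.subset[OF sH] by blast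
  then obtain K where K: "maximal_subgroup K G" "?R \<subseteq> K"
    using maximal_subgroup_exists[OF fin sR] by blast
  have sK: "subgroup K G" using K by (simp add: maximal_subgroup_def)
  have "commutator_subgroup G K (carrier G) \<subseteq> K"
    using commutator_subgroup_mono[OF subgroup.subset[OF sK] subset_refl] GR K(2) by blast
  then have "K \<lhd> G" using normal_of_commutator_le[OF sK] by blast
  then have "commutator_subgroup G K (carrier G) \<subseteq> H"
    using normal_IC_Phi_commutator_le[OF fin IC[OF K(1)]] frattini_le_maximal[OF H] by blast
  then have "K \<subseteq> H" using maximal_subgroup_normal_or_le[OF fin H sK] not by blast
  then show False using K(2) \<open>\<not> ?R \<subseteq> H\<close> by blast
qed

text \<open>Shrinking the ambient group to \<open>K\<close> only shrinks the commutator subgroup,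
  while \<Phi>(H) depends on \<open>H\<close> alone.\<close>

lemma IC_Phi_subgroup_carrier_update:
  assumes "IC_Phi_subgroup H G" "subgroup K G" "H \<subseteq> K"
  shows "IC_Phi_subgroup H (G\<lparr>carrier := K\<rparr>)"
  using assms commutator_subgroup_carrier_update[OF assms(2,3) subset_refl]
    commutator_subgroup_mono[OF subset_refl subgroup.subset[OF assms(2)], of H]
  by (auto simp: IC_Phi_subgroup_def subgroup_carrier_update_iff)

text \<open>Since NL = G, the quotient G/N is a quotient of \<open>L\<close>, in which all maximal
  subgroups are normal. Concretely, \<open>K\<close> equals NH for a maximal subgroup
  \<open>H\<close> of \<open>L\<close>, and an element of \<open>L\<close> outside \<open>K\<close>
  normalizes both factors.\<close>

lemma maximal_subgroup_over_normal_is_normal: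
  assumes fin: "finite (carrier G)"
    and N: "N \<lhd> G" and K: "maximal_subgroup K G" "N \<subseteq> K"
    and L: "maximal_subgroup L G" "\<not> N \<subseteq> L"
    and Ln: "\<And>H. maximal_subgroup H (G\<lparr>carrier := L\<rparr>) \<Longrightarrow> H \<lhd> G\<lparr>carrier := L\<rparr>"
  shows "K \<lhd> G"
proof -
  have sK: "subgroup K G" and sL: "subgroup L G" using K L by (auto simp: maximal_subgroup_def)
  have sN: "subgroup N G" using N by (rule normal_imp_subgroup)
  have NL: "N <#> L = carrier G" using maximal_subgroup_set_mult[OF N L] .
  have "\<not> L \<subseteq> K" using K L unfolding maximal_subgroup_def by blast
  then have "L \<inter> K \<subset> L" by blast
  then obtain H where H: "maximal_subgroup H (G\<lparr>carrier := L\<rparr>)" "L \<inter> K \<subseteq> H"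
    using maximal_subgroup_in_exists[OF fin sL] subgroups_Inter_pair[OF sL sK] by blast
  have sH: "subgroup H G" "H \<subset> L" using H maximal_subgroup_carrier_update_iff[OF sL] by auto
  have Nc: "n \<in> carrier G" if "n \<in> N" for n using that sN by (simp add: subgroup.mem_carrier)
  have Lc: "n \<in> carrier G" if "n \<in> L" for n using that sL by (simp add: subgroup.mem_carrier)
  \<comment> \<open>The modular law again: K = N(L \<inter> K), and L \<inter> K \<le> H.\<close>
  have KNH: "K \<subseteq> N <#> H"
  proof
    fix k assume k: "k \<in> K"
    then have "k \<in> N <#> L" using NL sK by (auto simp: subgroup.mem_carrier)
    then obtain n l where nl: "n \<in> N" "l \<in> L" "k = n \<otimes> l" by (auto simp: set_mult_def)
    have "inv n \<otimes> k \<in> K"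
      using nl k K(2) by (intro subgroup.m_closed[OF sK] subgroup.m_inv_closed[OF sK]) auto
    then have "l \<in> K" using nl Nc Lc by (simp add: word_simps)
    then show "k \<in> N <#> H" using nl H by (auto simp: set_mult_def)
  qed
  \<comment> \<open>If NH were \<open>G\<close>, write an element l of \<open>L\<close> outside
    \<open>H\<close> as n h. Then n lies in N \<inter> L, hence in K \<inter> L \<le> H, and so l
    would lie in \<open>H\<close>.\<close>
  have "N <#> H \<noteq> carrier G"
  proof
    assume eq: "N <#> H = carrier G"
    obtain l where l: "l \<in> L" "l \<notin> H" using sH by blast
    then have "l \<in> N <#> H" using eq Lc by blast
    then obtain n h where nh: "n \<in> N" "h \<in> H" "l = n \<otimes> h" by (auto simp: set_mult_def)
    have "l \<otimes> inv h \<in> L"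
      using nh l sH by (intro subgroup.m_closed[OF sL] subgroup.m_inv_closed[OF sL]) auto
    moreover have "h \<in> carrier G" using nh sH Lc by blast
    ultimately have "n \<in> L" using nh Nc by (simp add: word_simps)
    then have "n \<in> H" using nh K H by blast
    then show False using l nh subgroup.m_closed[OF sH(1)] by blast
  qed
  then have KNH: "K = N <#> H"
    using KNH K(1) mult_norm_subgroup[OF N sH(1)] unfolding maximal_subgroup_def by blast
  interpret H: normal H "G\<lparr>carrier := L\<rparr>" using Ln[OF H(1)] .
  obtain l where l: "l \<in> L" "l \<notin> K" using \<open>\<not> L \<subseteq> K\<close> by blast
  show "K \<lhd> G"
  proof (rule maximal_subgroup_normalI[OF fin K(1) Lc[OF l(1)] l(2)])
    fix k assume k: "k \<in> K"
    then obtain n h where nh: "n \<in> N" "h \<in> H" "k = n \<otimes> h" by (auto simp: KNH set_mult_def)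
    have c: "l \<in> carrier G" "n \<in> carrier G" "h \<in> carrier G" using l nh Nc Lc sH by auto
    have "l \<otimes> h \<otimes> inv l \<in> H" using H.inv_op_closed2[of l h] l nh m_inv_consistent[OF sL l(1)] by simp
    moreover have "l \<otimes> n \<otimes> inv l \<in> N" using normal_conj_closed(1)[OF N] c nh by blast
    ultimately have "(l \<otimes> n \<otimes> inv l) \<otimes> (l \<otimes> h \<otimes> inv l) \<in> K" unfolding KNH set_mult_def by blast
    then show "l \<otimes> k \<otimes> inv l \<in> K" using nh c by (simp add: word_simps)
  qed
qed

end

section \<open>Sylow subgroups and nilpotency\<close>

lemma exists_prime_power_decomposition:
  fixes n p :: nat
  assumes "Factorial_Ring.prime p" "n > 0"
  shows "\<exists>a m. n = p ^ a * m \<and> \<not> p dvd m"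
  using multiplicity_decompose'[of n p] assms by (metis not_prime_unit gr_implies_not0)

context group begin

section \<open>Actions and fixed points of p-groups\<close>

lemma group_actionI:
  assumes closed: "\<And>x e. x \<in> carrier G \<Longrightarrow> e \<in> E \<Longrightarrow> f x e \<in> E"
    and one: "\<And>e. e \<in> E \<Longrightarrow> f \<one> e = e"
    and comp: "\<And>x y e. x \<in> carrier G \<Longrightarrow> y \<in> carrier G \<Longrightarrow> e \<in> E \<Longrightarrow> f (x \<otimes> y) e = f x (f y e)"
  shows "group_action G E (\<lambda>x. restrict (f x) E)"
proof -
  have inv: "f (inv x) (f x e) = e" "f x (f (inv x) e) = e" if "x \<in> carrier G" "e \<in> E" for x e
    using comp[of "inv x" x e] comp[of x "inv x" e] one that by auto
  have bij: "restrict (f x) E \<in> Bij E" if "x \<in> carrier G" for x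
  proof -
    have "bij_betw (f x) E E"
      by (rule bij_betw_byWitness[of _ "f (inv x)"]) (use that inv closed in auto)
    then show ?thesis by (simp add: Bij_def)
  qed
  have "(\<lambda>x. restrict (f x) E) \<in> hom G (BijGroup E)"
  proof (rule homI)
    fix x y assume xy: "x \<in> carrier G" "y \<in> carrier G"
    have "restrict (f (x \<otimes> y)) E = compose E (restrict (f x) E) (restrict (f y) E)"
      unfolding compose_def using comp[OF xy] closed xy by (auto simp: restrict_def)
    then show "restrict (f (x \<otimes> y)) E = restrict (f x) E \<otimes>\<^bsub>BijGroup E\<^esub> restrict (f y) E"
      using bij xy by (simp add: BijGroup_def)
  qed (use bij in \<open>simp add: BijGroup_def\<close>)
  then show ?thesis
    by (simp add: group_action_def group_hom_def group_hom_axioms_def group_axioms group_BijGroup)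
qed

text \<open>Orbit sizes divide p^n. Without a fixed point each orbit would have size divisible by p,
  and so would \<open>E\<close>, their disjoint union.\<close>

lemma p_group_fixed_point:
  assumes ord: "order G = p ^ n" and p: "Factorial_Ring.prime p" and fin: "finite E" and card: "\<not> p dvd card E"
    and closed: "\<And>x e. x \<in> carrier G \<Longrightarrow> e \<in> E \<Longrightarrow> f x e \<in> E"
    and one: "\<And>e. e \<in> E \<Longrightarrow> f \<one> e = e"
    and comp: "\<And>x y e. x \<in> carrier G \<Longrightarrow> y \<in> carrier G \<Longrightarrow> e \<in> E \<Longrightarrow> f (x \<otimes> y) e = f x (f y e)"
  shows "\<exists>e\<in>E. \<forall>x\<in>carrier G. f x e = e"
proof (rule ccontr)
  assume no: "\<not> ?thesis"
  let ?f = "\<lambda>x. restrict (f x) E"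
  interpret group_action G E ?f using assms by (intro group_actionI) auto
  have part: "partition E (orbits G E ?f)" by (rule orbit_partition)
  have Un: "\<Union> (orbits G E ?f) = E"
    using partition.unique_class[OF part] partition.incl[OF part] by blast
  have "p dvd card (\<Union> (orbits G E ?f))"
  proof (rule dvd_partition)
    show "finite (\<Union> (orbits G E ?f))" using Un fin by simp
    show "\<forall>c1\<in>orbits G E ?f. \<forall>c2\<in>orbits G E ?f. c1 \<noteq> c2 \<longrightarrow> c1 \<inter> c2 = {}"
      using partition.unique_class[OF part] partition.incl[OF part] by (metis disjoint_iff subsetD)
    show "\<forall>c\<in>orbits G E ?f. p dvd card c"
    proof
      fix c assume "c \<in> orbits G E ?f"
      then obtain e where e: "e \<in> E" "c = orbit G ?f e" by (auto simp: orbits_def)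
      have "card c dvd p ^ n"
        using orbit_stabilizer_theorem[OF e(1)] e(2) ord by (metis dvd_triv_left)
      then obtain k where k: "card c = p ^ k" using p by (auto simp: divides_primepow_nat)
      have "card c \<noteq> 1"
      proof
        assume "card c = 1"
        then obtain e' where c: "c = {e'}" by (auto simp: card_1_singleton_iff)
        have "f x e = e" if "x \<in> carrier G" for x
        proof -
          have "f x e \<in> c" "f \<one> e \<in> c" using e that by (auto simp: orbit_def)
          then show ?thesis using c one[OF e(1)] by simp
        qed
        then show False using no e by blast
      qed
      then show "p dvd card c" using k by (cases k) auto
    qed
  qed
  then show False using Un card by simp
qed

text \<open>The p-group acts on the right cosets of \<open>Q\<close>, and a fixed coset Qg says that
  g conjugates its image into \<open>Q\<close>. A homomorphism is allowed instead of an inclusion so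
  that the Frattini argument can use conjugation as the map.\<close>

lemma p_group_conj_into:
  assumes fin: "finite (carrier G)" and H: "group H" "order H = p ^ n" and p: "Factorial_Ring.prime p"
    and \<phi>: "\<phi> \<in> hom H G" and Q: "subgroup Q G" and card: "\<not> p dvd card (rcosets Q)"
  shows "\<exists>g\<in>carrier G. \<forall>x\<in>carrier H. g \<otimes> \<phi> x \<otimes> inv g \<in> Q"
proof -
  interpret H: group H by fact
  interpret \<phi>: group_hom H G \<phi> by unfold_locales fact
  have Qc: "Q \<subseteq> carrier G" using Q by (rule subgroup.subset)
  \<comment> \<open>Inverting x turns right multiplication of cosets into a left action.\<close>
  have "\<exists>e\<in>rcosets Q. \<forall>x\<in>carrier H. e #> \<phi> (inv\<^bsub>H\<^esub> x) = e"
  proof (rule H.p_group_fixed_point[OF H(2) p _ card])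
    show "finite (rcosets Q)" using fin by (auto simp: RCOSETS_def)
    fix x y e assume x: "x \<in> carrier H" and e: "e \<in> rcosets Q"
    then obtain g where g: "g \<in> carrier G" "e = Q #> g" by (auto simp: RCOSETS_def)
    show "e #> \<phi> (inv\<^bsub>H\<^esub> x) \<in> rcosets Q"
      using g x Qc by (auto simp: coset_mult_assoc intro!: rcosetsI)
    assume y: "y \<in> carrier H"
    show "e #> \<phi> (inv\<^bsub>H\<^esub> (x \<otimes>\<^bsub>H\<^esub> y)) = e #> \<phi> (inv\<^bsub>H\<^esub> y) #> \<phi> (inv\<^bsub>H\<^esub> x)"
      using g x y Qc by (simp add: coset_mult_assoc H.inv_mult_group m_assoc)
  qed (auto simp: RCOSETS_def coset_mult_assoc Qc)
  then obtain g where g: "g \<in> carrier G"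
    and fixed: "\<And>x. x \<in> carrier H \<Longrightarrow> Q #> g #> \<phi> (inv\<^bsub>H\<^esub> x) = Q #> g"
    by (auto simp: RCOSETS_def)
  have "g \<otimes> \<phi> x \<otimes> inv g \<in> Q" if x: "x \<in> carrier H" for x
  proof -
    have "Q #> (g \<otimes> \<phi> x) = Q #> g"
      using fixed[of "inv\<^bsub>H\<^esub> x"] g x Qc by (simp add: coset_mult_assoc)
    then have "Q #> (g \<otimes> \<phi> x \<otimes> inv g) = Q" using g x Qc by (intro coset_mult_inv2) auto
    then show ?thesis using coset_join1[OF _ _ Q] g x by simp
  qed
  then show ?thesis using g by blast
qed

text \<open>\<open>P\<close> acts on its right cosets and fixes the coset \<open>P\<close>. The
  number of the others is -1 modulo p, so a second coset Pg is fixed, and g normalizes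
  \<open>P\<close> without lying in it.\<close>

lemma p_subgroup_normalizer_grows:
  assumes fin: "finite (carrier G)" and P: "subgroup P G" "card P = p ^ n" and p: "Factorial_Ring.prime p"
    and card: "p dvd card (rcosets P)"
  shows "\<exists>g\<in>carrier G - P. \<forall>x\<in>P. g \<otimes> x \<otimes> inv g \<in> P"
proof -
  interpret P: group "G\<lparr>carrier := P\<rparr>" using P(1) by (rule subgroup_imp_group)
  have Pc: "P \<subseteq> carrier G" using P(1) by (rule subgroup.subset)
  have finR: "finite (rcosets P)" using fin by (auto simp: RCOSETS_def)
  have PR: "P \<in> rcosets P" using rcosetsI[OF Pc one_closed] Pc by simp
  have "\<exists>e\<in>rcosets P - {P}. \<forall>x\<in>carrier (G\<lparr>carrier := P\<rparr>). e #> inv x = e"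
  proof (rule P.p_group_fixed_point[OF _ p])
    show "order (G\<lparr>carrier := P\<rparr>) = p ^ n" using P by (simp add: order_def)
    show "finite (rcosets P - {P})" using finR by simp
    have "card (rcosets P) = Suc (card (rcosets P - {P}))"
      using card.remove[OF finR PR] .
    then show "\<not> p dvd card (rcosets P - {P})"
      using card p by (metis Suc_eq_plus1 dvd_add_right_iff nat_dvd_1_iff_1 not_prime_1)
    fix x y e assume x: "x \<in> carrier (G\<lparr>carrier := P\<rparr>)" and e: "e \<in> rcosets P - {P}"
    then obtain g where g: "g \<in> carrier G" "e = P #> g" "P #> g \<noteq> P" by (auto simp: RCOSETS_def)
    have xP: "x \<in> P" and xc: "x \<in> carrier G" using x Pc by auto
    have "P #> (g \<otimes> inv x) \<noteq> P"
    proof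
      assume "P #> (g \<otimes> inv x) = P"
      then have "g \<otimes> inv x \<in> P" using coset_join1[OF _ _ P(1)] g xc by simp
      then have "g \<otimes> inv x \<otimes> x \<in> P" using subgroup.m_closed[OF P(1)] xP by blast
      then have "g \<in> P" using g xc by (simp add: m_assoc)
      then show False using coset_join2[OF _ P(1)] g by blast
    qed
    then show "e #> inv x \<in> rcosets P - {P}"
      using g xc Pc by (auto simp: coset_mult_assoc intro!: rcosetsI)
    assume y: "y \<in> carrier (G\<lparr>carrier := P\<rparr>)"
    then have yc: "y \<in> carrier G" using Pc by auto
    show "e #> inv (x \<otimes>\<^bsub>G\<lparr>carrier := P\<rparr>\<^esub> y) = e #> inv y #> inv x"
      using g xc yc Pc by (simp add: coset_mult_assoc inv_mult_group m_assoc)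
  qed (auto simp: RCOSETS_def coset_mult_assoc Pc)
  then obtain g where g: "g \<in> carrier G" "P #> g \<noteq> P"
    and fixed: "\<And>x. x \<in> P \<Longrightarrow> P #> g #> inv x = P #> g"
    by (auto simp: RCOSETS_def)
  have "g \<otimes> x \<otimes> inv g \<in> P" if x: "x \<in> P" for x
  proof -
    have xc: "x \<in> carrier G" using x Pc by auto
    have "P #> (g \<otimes> x) = P #> g"
      using fixed[of "inv x"] g x xc Pc subgroup.m_inv_closed[OF P(1) x] by (simp add: coset_mult_assoc)
    then have "P #> (g \<otimes> x \<otimes> inv g) = P" using g xc Pc by (intro coset_mult_inv2) auto
    then show ?thesis using coset_join1[OF _ _ P(1)] g xc by simp
  qed
  moreover have "g \<notin> P" using coset_join2[OF g(1) P(1)] g(2) by blast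
  ultimately show ?thesis using g by blast
qed

section \<open>Indices and Sylow subgroups\<close>

lemma card_subgroup_dvd:
  assumes "finite (carrier G)" "subgroup H G" "subgroup K G" "H \<subseteq> K"
  shows "card H dvd card K"
proof -
  interpret K: group "G\<lparr>carrier := K\<rparr>" using assms(3) by (rule subgroup_imp_group)
  have "card (rcosets\<^bsub>G\<lparr>carrier := K\<rparr>\<^esub> H) * card H = card K"
    using K.lagrange_finite[of H] assms subgroup_carrier_update_iff[OF assms(3)]
      finite_subset[OF subgroup.subset[OF assms(3)] assms(1)] by (simp add: order_def)
  then show ?thesis by (metis dvd_triv_right)
qed

lemma card_subgroup_pos:
  assumes "finite (carrier G)" "subgroup H G"
  shows "card H > 0"
  using assms by (metis card_gt_0_iff empty_iff finite_subset subgroup.one_closed subgroup.subset)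

lemma index_dvd:
  assumes fin: "finite (carrier G)" and H: "subgroup H G" and K: "subgroup K G" and "H \<subseteq> K"
  shows "card (rcosets K) dvd card (rcosets H)"
proof -
  obtain t where t: "card K = card H * t" using card_subgroup_dvd[OF assms] by (auto elim: dvdE)
  have "card (rcosets K) * card K = card (rcosets H) * card H"
    using lagrange_finite[OF fin] H K by simp
  then have "card (rcosets K) * t = card (rcosets H)"
    using card_subgroup_pos[OF fin H] t by (simp add: mult.left_commute mult.commute)
  then show ?thesis by (metis dvd_triv_left)
qed

lemma index_gt_one:
  assumes fin: "finite (carrier G)" and H: "subgroup H G" "H \<noteq> carrier G"
  shows "card (rcosets H) > 1"
proof -
  have "card (rcosets H) * card H = order G" using lagrange_finite[OF fin H(1)] .
  moreover have "order G > 0" using fin by (simp add: order_gt_0_iff_finite)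
  moreover have "card H \<noteq> order G" using card_eq_imp_carrier[OF fin H(1)] H(2) by blast
  ultimately have "card (rcosets H) \<noteq> 1" "card (rcosets H) \<noteq> 0"
    by (metis mult_1, metis mult_is_0 less_irrefl)
  then show ?thesis by linarith
qed

text \<open>The condition is put on the index rather than on the exponent of p in the group order,
  since the fixed-point counts and the divisibility arguments use the index.\<close>

definition sylow_subgroup :: "nat \<Rightarrow> 'a set \<Rightarrow> bool" where
  "sylow_subgroup p P \<longleftrightarrow> subgroup P G \<and> (\<exists>a. card P = p ^ a) \<and> \<not> p dvd card (rcosets P)"

lemma sylow_subgroup_exists:
  assumes fin: "finite (carrier G)" and p: "Factorial_Ring.prime p"
  shows "\<exists>P. sylow_subgroup p P"
proof -
  have "order G > 0" using fin by (simp add: order_gt_0_iff_finite)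
  then obtain a m where am: "order G = p ^ a * m" "\<not> p dvd m"
    using exists_prime_power_decomposition[OF p] by blast
  obtain P where P: "subgroup P G" "card P = p ^ a"
    using sylow_thm[OF p group_axioms am(1) fin] by blast
  have "card (rcosets P) = m"
    using lagrange_finite[OF fin P(1)] P(2) am(1) p by (simp add: mult.commute prime_gt_0_nat)
  then show ?thesis using P am by (auto simp: sylow_subgroup_def)
qed

text \<open>Every p-subgroup is conjugate into a Sylow subgroup, and a normal one equals its
  conjugates.\<close>

lemma normal_sylow_subgroup_contains:
  assumes fin: "finite (carrier G)" and p: "Factorial_Ring.prime p" and P: "sylow_subgroup p P" "P \<lhd> G"
    and T: "subgroup T G" "card T = p ^ b"
  shows "T \<subseteq> P"
proof
  fix t assume t: "t \<in> T"
  have "\<exists>g\<in>carrier G. \<forall>x\<in>carrier (G\<lparr>carrier := T\<rparr>). g \<otimes> (\<lambda>x. x) x \<otimes> inv g \<in> P"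
    using P(1) subgroup_imp_group[OF T(1)] T subgroup.subset[OF T(1)]
    by (intro p_group_conj_into[OF fin _ _ p, where n = b])
      (auto simp: sylow_subgroup_def order_def hom_def)
  then obtain g where g: "g \<in> carrier G" "g \<otimes> t \<otimes> inv g \<in> P" using t by auto
  have "t \<in> carrier G" using t T by (simp add: subgroup.mem_carrier)
  then show "t \<in> P" using normal_conj_closed(2)[OF P(2) g] g(1) by (simp add: word_simps)
qed

text \<open>Take a prime p dividing the index of \<open>F\<close>. A proper Sylow p-subgroup would
  lie in \<open>F\<close>, so p would divide its index; hence the Sylow subgroup is the whole
  group.\<close>

lemma unique_maximal_imp_prime_power_order:
  assumes fin: "finite (carrier G)" and F: "subgroup F G" "F \<noteq> carrier G"
    and le: "\<And>H. subgroup H G \<Longrightarrow> H \<noteq> carrier G \<Longrightarrow> H \<subseteq> F"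
  shows "\<exists>p n. Factorial_Ring.prime (p::nat) \<and> order G = p ^ n"
proof -
  obtain p :: nat where p: "Factorial_Ring.prime p" "p dvd card (rcosets F)"
    using index_gt_one[OF fin F] prime_factor_nat[of "card (rcosets F)"] by auto
  obtain P where P: "sylow_subgroup p P" using sylow_subgroup_exists[OF fin p(1)] by blast
  then have sP: "subgroup P G" by (simp add: sylow_subgroup_def)
  have "P = carrier G"
  proof (rule ccontr)
    assume "P \<noteq> carrier G"
    then have "card (rcosets F) dvd card (rcosets P)" using index_dvd[OF fin sP F(1)] le[OF sP] by blast
    then show False using p(2) P by (auto simp: sylow_subgroup_def)
  qed
  then show ?thesis using P p(1) by (auto simp: sylow_subgroup_def order_def)
qed

lemma p_group_maximal_normal:
  assumes fin: "finite (carrier G)" and ord: "order G = p ^ n" and p: "Factorial_Ring.prime p"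
    and M: "maximal_subgroup M G"
  shows "M \<lhd> G"
proof -
  have sM: "subgroup M G" "M \<noteq> carrier G" using M by (auto simp: maximal_subgroup_def)
  have "card (rcosets M) * card M = p ^ n" using lagrange_finite[OF fin sM(1)] ord by simp
  then have "card M dvd p ^ n" "card (rcosets M) dvd p ^ n" by (metis dvd_triv_left dvd_triv_right)+
  then obtain k l where k: "card M = p ^ k" "card (rcosets M) = p ^ l"
    using p by (auto simp: divides_primepow_nat)
  have "p dvd card (rcosets M)" using index_gt_one[OF fin sM] k(2) by (cases l) auto
  then obtain g where "g \<in> carrier G - M" "\<forall>x\<in>M. g \<otimes> x \<otimes> inv g \<in> M"
    using p_subgroup_normalizer_grows[OF fin sM(1) k(1) p] by blast
  then show ?thesis using maximal_subgroup_normalI[OF fin M] by blast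
qed

text \<open>The Frattini argument.\<close>

lemma sylow_subgroup_normal:
  assumes fin: "finite (carrier G)" and p: "Factorial_Ring.prime p" and P: "sylow_subgroup p P"
    and max: "\<And>M. maximal_subgroup M G \<Longrightarrow> M \<lhd> G"
  shows "P \<lhd> G"
proof (rule ccontr)
  assume not: "\<not> P \<lhd> G"
  have sP: "subgroup P G" using P by (simp add: sylow_subgroup_def)
  obtain a where a: "card P = p ^ a" using P by (auto simp: sylow_subgroup_def)
  have Pc: "P \<subseteq> carrier G" using sP by (rule subgroup.subset)
  let ?Z = "{g \<in> carrier G. \<forall>m\<in>P. g \<otimes> m \<otimes> inv g \<in> P}"
  have sZ: "subgroup ?Z G" using finite_normalizer_subgroup[OF sP] finite_subset[OF Pc fin] by blast
  have "?Z \<noteq> carrier G" using not sP unfolding normal_inv_iff by blast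
  then obtain K where K: "maximal_subgroup K G" "?Z \<subseteq> K"
    using maximal_subgroup_exists[OF fin sZ] by blast
  have sK: "subgroup K G" using K by (simp add: maximal_subgroup_def)
  have KG: "K \<lhd> G" using max K by blast
  have PZ: "P \<subseteq> ?Z" using sP
    by (auto simp: subgroup.mem_carrier subgroup.m_closed subgroup.m_inv_closed)
  then have PK: "P \<subseteq> K" using K by blast
  interpret K: group "G\<lparr>carrier := K\<rparr>" using sK by (rule subgroup_imp_group)
  have finK: "finite K" using finite_subset[OF subgroup.subset[OF sK] fin] .
  have sPK: "subgroup P (G\<lparr>carrier := K\<rparr>)" using subgroup_carrier_update_iff[OF sK] sP PK by blast
  have "card (rcosets\<^bsub>G\<lparr>carrier := K\<rparr>\<^esub> P) * card P = card K"
    using K.lagrange_finite[OF _ sPK] finK by (simp add: order_def)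
  then have "card (rcosets K) * card (rcosets\<^bsub>G\<lparr>carrier := K\<rparr>\<^esub> P) * card P = card (rcosets P) * card P"
    using lagrange_finite[OF fin sK] lagrange_finite[OF fin sP] by (simp add: mult.assoc)
  then have "card (rcosets K) * card (rcosets\<^bsub>G\<lparr>carrier := K\<rparr>\<^esub> P) = card (rcosets P)"
    using card_subgroup_pos[OF fin sP] by simp
  \<comment> \<open>The index of \<open>P\<close> in \<open>K\<close> divides its index in
    \<open>G\<close>, so \<open>P\<close> is also Sylow in \<open>K\<close>.\<close>
  then have ndvd: "\<not> p dvd card (rcosets\<^bsub>G\<lparr>carrier := K\<rparr>\<^esub> P)"
    using P by (metis dvd_mult sylow_subgroup_def)
  have "carrier G \<subseteq> K"
  proof
    fix g assume g: "g \<in> carrier G"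
    \<comment> \<open>As \<open>K\<close> is normal it contains g P g^-1, which some k in
      \<open>K\<close> therefore conjugates into \<open>P\<close>. Then kg normalizes
      \<open>P\<close>, so kg, and with it g, lies in \<open>K\<close>.\<close>
    have "\<exists>k\<in>carrier (G\<lparr>carrier := K\<rparr>). \<forall>x\<in>carrier (G\<lparr>carrier := P\<rparr>).
        k \<otimes>\<^bsub>G\<lparr>carrier := K\<rparr>\<^esub> (g \<otimes> x \<otimes> inv g) \<otimes>\<^bsub>G\<lparr>carrier := K\<rparr>\<^esub> inv\<^bsub>G\<lparr>carrier := K\<rparr>\<^esub> k \<in> P"
    proof (rule K.p_group_conj_into[OF _ _ _ p _ sPK ndvd])
      show "(\<lambda>x. g \<otimes> x \<otimes> inv g) \<in> hom (G\<lparr>carrier := P\<rparr>) (G\<lparr>carrier := K\<rparr>)"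
      proof (rule homI)
        show "g \<otimes> x \<otimes> inv g \<in> carrier (G\<lparr>carrier := K\<rparr>)" if "x \<in> carrier (G\<lparr>carrier := P\<rparr>)" for x
          using normal_conj_closed(1)[OF KG g] that PK by auto
        show "g \<otimes> (x \<otimes>\<^bsub>G\<lparr>carrier := P\<rparr>\<^esub> y) \<otimes> inv g = g \<otimes> x \<otimes> inv g \<otimes>\<^bsub>G\<lparr>carrier := K\<rparr>\<^esub> (g \<otimes> y \<otimes> inv g)"
          if "x \<in> carrier (G\<lparr>carrier := P\<rparr>)" "y \<in> carrier (G\<lparr>carrier := P\<rparr>)" for x y
          using that g Pc by (auto simp: word_simps subset_iff)
      qed
    qed (use finK subgroup_imp_group[OF sP] a in \<open>auto simp: order_def\<close>)
    then obtain k where k: "k \<in> K" "\<And>x. x \<in> P \<Longrightarrow> k \<otimes> (g \<otimes> x \<otimes> inv g) \<otimes> inv k \<in> P"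
      using m_inv_consistent[OF sK] by auto
    have kc: "k \<in> carrier G" using k sK by (simp add: subgroup.mem_carrier)
    have "(k \<otimes> g) \<otimes> x \<otimes> inv (k \<otimes> g) \<in> P" if "x \<in> P" for x
      using k(2)[OF that] that Pc g kc by (auto simp: word_simps subset_iff)
    then have "k \<otimes> g \<in> K" using K(2) g kc by auto
    then have "inv k \<otimes> (k \<otimes> g) \<in> K"
      using subgroup.m_closed[OF sK subgroup.m_inv_closed[OF sK k(1)]] by blast
    then show "g \<in> K" using g kc by (simp add: word_simps)
  qed
  then show False using K(1) subgroup.subset[OF sK] by (auto simp: maximal_subgroup_def)
qed

section \<open>From normal Sylow subgroups to nilpotency\<close>

lemma normal_p_subgroup_fixed_coset:
  assumes fin: "finite (carrier G)" and p: "Factorial_Ring.prime p"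
    and P: "P \<lhd> G" "card P = p ^ a" and N: "N \<lhd> G" and U: "U \<lhd> G" "U \<subseteq> N"
    and card: "p dvd card (rcosets\<^bsub>G\<lparr>carrier := N\<rparr>\<^esub> U)"
  shows "\<exists>x\<in>N - U. x \<in> centralizer_mod P U"
proof -
  have sN: "subgroup N G" and sU: "subgroup U G" and sP: "subgroup P G"
    using N U P by (auto simp: normal_imp_subgroup)
  have Pc: "P \<subseteq> carrier G" and Uc: "U \<subseteq> carrier G" and Nc: "N \<subseteq> carrier G"
    using sP sU sN by (auto simp: subgroup.subset)
  interpret P: group "G\<lparr>carrier := P\<rparr>" using sP by (rule subgroup_imp_group)
  let ?R = "rcosets\<^bsub>G\<lparr>carrier := N\<rparr>\<^esub> U"
  \<comment> \<open>\<open>f\<close> is the conjugation action of \<open>P\<close> on N/U. A fixed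
    coset other than \<open>U\<close> yields an element of \<open>N\<close> outside \<open>U\<close>
    that centralizes \<open>P\<close> modulo \<open>U\<close>.\<close>
  define f where "f y e = (y <# e) #> inv y" for y e
  have f: "f y (U #> x) = U #> (y \<otimes> x \<otimes> inv y)" if "x \<in> carrier G" "y \<in> carrier G" for x y
  proof -
    have "y <# (U #> x) = U #> y #> x"
      using coset_assoc[OF that(2,1) Uc] normal.coset_eq[OF U(1)] that by simp
    then show ?thesis using that Uc by (simp add: f_def coset_mult_assoc)
  qed
  have R: "?R = (\<lambda>x. U #> x) ` N" by (auto simp: RCOSETS_def)
  have finR: "finite ?R" using R finite_subset[OF Nc fin] by simp
  have UR: "U \<in> ?R" 
    unfolding R using imageI[of \<one> N "\<lambda>x. U #> x", OF subgroup.one_closed[OF sN]] Uc by simp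
  have "\<exists>e\<in>?R - {U}. \<forall>y\<in>carrier (G\<lparr>carrier := P\<rparr>). f y e = e"
  proof (rule P.p_group_fixed_point[OF _ p])
    show "order (G\<lparr>carrier := P\<rparr>) = p ^ a" using P by (simp add: order_def)
    show "finite (?R - {U})" using finR by simp
    \<comment> \<open>The trivial coset \<open>U\<close> is always fixed; leaving it out makes the
      count -1 modulo p, so a nontrivial fixed coset exists.\<close>
    have "card ?R = Suc (card (?R - {U}))" using card.remove[OF finR UR] .
    then show "\<not> p dvd card (?R - {U})"
      using card p by (metis Suc_eq_plus1 dvd_add_right_iff nat_dvd_1_iff_1 not_prime_1)
    fix e assume "e \<in> ?R - {U}"
    then obtain x where x: "x \<in> N" "e = U #> x" "U #> x \<noteq> U" using R by auto
    have xc: "x \<in> carrier G" using x Nc by blast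
    show "f \<one>\<^bsub>G\<lparr>carrier := P\<rparr>\<^esub> e = e" using x xc by (simp add: f)
    fix y assume "y \<in> carrier (G\<lparr>carrier := P\<rparr>)"
    then have y: "y \<in> carrier G" using Pc by auto
    have "U #> (y \<otimes> x \<otimes> inv y) \<noteq> U"
    proof
      assume "U #> (y \<otimes> x \<otimes> inv y) = U"
      then have "y \<otimes> x \<otimes> inv y \<in> U" using coset_join1[OF _ _ sU] xc y by simp
      from normal_conj_closed(2)[OF U(1) y this] have "x \<in> U" using xc y by (simp add: word_simps)
      then show False using coset_join2[OF xc sU] x by blast
    qed
    then show "f y e \<in> ?R - {U}"
      using x xc y normal_conj_closed(1)[OF N y x(1)] by (auto simp: f R)
    fix z assume "z \<in> carrier (G\<lparr>carrier := P\<rparr>)"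
    then have z: "z \<in> carrier G" using Pc by auto
    show "f (y \<otimes>\<^bsub>G\<lparr>carrier := P\<rparr>\<^esub> z) e = f y (f z e)"
      using x xc y z by (simp add: f inv_mult_group m_assoc)
  qed
  then obtain e where e: "e \<in> ?R" "e \<noteq> U" "\<And>y. y \<in> P \<Longrightarrow> f y e = e" by auto
  obtain x where "x \<in> N" "e = U #> x" using e(1) R by blast
  then have x: "x \<in> N" "U #> x \<noteq> U" "\<And>y. y \<in> P \<Longrightarrow> f y (U #> x) = U #> x"
    using e by auto
  have xc: "x \<in> carrier G" using x Nc by blast
  have "P \<subseteq> centralizer_mod {x} U"
  proof
    fix y assume y: "y \<in> P"
    then have yc: "y \<in> carrier G" using Pc by blast
    have "U #> (y \<otimes> x \<otimes> inv y) = U #> x" using x(3)[OF y] f xc yc by simp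
    then have "U #> (y \<otimes> x \<otimes> inv y \<otimes> inv x) = U" using xc yc Uc by (intro coset_mult_inv2) auto
    then have "y \<otimes> x \<otimes> inv y \<otimes> inv x \<in> U" using coset_join1[OF _ _ sU] xc yc by simp
    then show "y \<in> centralizer_mod {x} U" using yc by (simp add: centralizer_mod_def)
  qed
  then have "x \<in> centralizer_mod P U"
    using centralizer_mod_commute[OF U(1) _ Pc, of "{x}"] xc by auto
  moreover have "x \<notin> U" using x(2) coset_join2[OF xc sU] by blast
  ultimately show ?thesis using x by blast
qed

text \<open>A chief factor N/U lying at the top of \<open>N\<close> is shown to be central in G/U,
  by checking that each Sylow subgroup of \<open>G\<close> centralizes it.\<close>

lemma normal_commutator_proper:
  assumes fin: "finite (carrier G)"
    and syl: "\<And>p P. Factorial_Ring.prime p \<Longrightarrow> sylow_subgroup p P \<Longrightarrow> P \<lhd> G"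
    and N: "N \<lhd> G" "N \<noteq> {\<one>}"
  shows "commutator_subgroup G N (carrier G) \<subset> N"
proof -
  have sN: "subgroup N G" using N by (simp add: normal_imp_subgroup)
  have Nc: "N \<subseteq> carrier G" using sN by (rule subgroup.subset)
  have finN: "finite N" using finite_subset[OF Nc fin] .
  let ?S = "{U. U \<lhd> G \<and> U \<subset> N}"
  have finS: "finite ?S" by (rule finite_subset[of _ "Pow N"]) (use finN in auto)
  have oneS: "{\<one>} \<in> ?S" using N subgroup.one_closed[OF sN] one_is_normal by auto
  obtain U where "U \<in> ?S" and maxU: "\<forall>V\<in>?S. U \<subseteq> V \<longrightarrow> U = V"
    using finite_has_maximal2[OF finS oneS] by (elim bexE conjE) rule
  then have U: "U \<lhd> G" "U \<subset> N" by simp_all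
  have Umax: "V = U" if "V \<lhd> G" "U \<subseteq> V" "V \<subset> N" for V
    using bspec[OF maxU, of V] that by simp
  have sU: "subgroup U G" using U by (simp add: normal_imp_subgroup)
  have Uc: "U \<subseteq> carrier G" using sU by (rule subgroup.subset)
  interpret N: group "G\<lparr>carrier := N\<rparr>" using sN by (rule subgroup_imp_group)
  have sUN: "subgroup U (G\<lparr>carrier := N\<rparr>)" using sU U subgroup_carrier_update_iff[OF sN] by blast
  have "U \<noteq> N" using U(2) by blast
  then have index: "card (rcosets\<^bsub>G\<lparr>carrier := N\<rparr>\<^esub> U) > 1"
    using N.index_gt_one[OF _ sUN] finN by simp
  obtain p :: nat where p: "Factorial_Ring.prime p" "p dvd card (rcosets\<^bsub>G\<lparr>carrier := N\<rparr>\<^esub> U)"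
    using prime_factor_nat[of "card (rcosets\<^bsub>G\<lparr>carrier := N\<rparr>\<^esub> U)"] index by auto
  obtain P where P: "sylow_subgroup p P" using sylow_subgroup_exists[OF fin p(1)] by blast
  then have PG: "P \<lhd> G" using syl p by blast
  obtain a where a: "card P = p ^ a" using P by (auto simp: sylow_subgroup_def)
  have sP: "subgroup P G" using PG by (rule normal_imp_subgroup)
  have Pc: "P \<subseteq> carrier G" using sP by (rule subgroup.subset)
  \<comment> \<open>The part of \<open>N\<close> centralizing \<open>P\<close> modulo
    \<open>U\<close> is normal in \<open>G\<close> and larger than \<open>U\<close>, so it is
    \<open>N\<close> by the choice of \<open>U\<close>.\<close>
  have NP: "N \<subseteq> centralizer_mod P U"
  proof -
    obtain x where x: "x \<in> N - U" "x \<in> centralizer_mod P U"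
      using normal_p_subgroup_fixed_coset[OF fin p(1) PG a N(1) U(1) _ p(2)] U by blast
    have "N \<inter> centralizer_mod P U \<lhd> G"
      using normal_subgroup_intersect[OF N(1) centralizer_mod_normal[OF U(1) PG]] .
    moreover have "U \<subseteq> N \<inter> centralizer_mod P U"
      using normal_subset_centralizer_mod[OF U(1) Pc] U by blast
    ultimately have "N \<inter> centralizer_mod P U = N" using Umax x by blast
    then show ?thesis by blast
  qed
  \<comment> \<open>A Sylow p-subgroup of \<open>N\<close> lies in \<open>P\<close> but not in
    \<open>U\<close>, because p divides the index of \<open>U\<close> in \<open>N\<close>. So U(N
    \<inter> P) is a normal subgroup of \<open>G\<close> larger than \<open>U\<close>.\<close>
  have NU: "U <#> (N \<inter> P) = N"
  proof -
    obtain T where T: "N.sylow_subgroup p T" using N.sylow_subgroup_exists[OF _ p(1)] finN by auto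
    then have sTN: "subgroup T (G\<lparr>carrier := N\<rparr>)" by (simp add: N.sylow_subgroup_def)
    then have sT: "subgroup T G" "T \<subseteq> N" using subgroup_carrier_update_iff[OF sN] by auto
    have "T \<subseteq> P"
      using normal_sylow_subgroup_contains[OF fin p(1) P PG sT(1)] T by (auto simp: N.sylow_subgroup_def)
    moreover have "\<not> T \<subseteq> U"
    proof
      assume "T \<subseteq> U"
      then have "card (rcosets\<^bsub>G\<lparr>carrier := N\<rparr>\<^esub> U) dvd card (rcosets\<^bsub>G\<lparr>carrier := N\<rparr>\<^esub> T)"
        using N.index_dvd[OF _ sTN sUN] finN by simp
      then show False using p(2) T by (auto simp: N.sylow_subgroup_def)
    qed
    ultimately have not: "\<not> N \<inter> P \<subseteq> U" using sT by blast
    have NPn: "N \<inter> P \<lhd> G" using normal_subgroup_intersect[OF N(1) PG] .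
    have sNP: "subgroup (N \<inter> P) G" using NPn by (rule normal_imp_subgroup)
    have "U <#> (N \<inter> P) \<lhd> G" using normal_subgroup_set_mult_closed U(1) NPn by blast
    moreover have "U <#> (N \<inter> P) \<subseteq> N" using set_mult_least[OF sN] U by blast
    ultimately show ?thesis using Umax[of "U <#> (N \<inter> P)"] subset_set_mult[OF sU sNP] not by blast
  qed
  \<comment> \<open>Otherwise a prime q divides the index of this centralizer; but a Sylow
    q-subgroup lies in it, for q = p by \<open>NP\<close>, and for other q because [N \<inter> P, Q]
    \<le> P \<inter> Q = 1.\<close>
  have "centralizer_mod N U = carrier G"
  proof (rule ccontr)
    assume ne: "centralizer_mod N U \<noteq> carrier G"
    have sD: "subgroup (centralizer_mod N U) G" using centralizer_mod_subgroup[OF U(1) Nc] .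
    obtain q :: nat where q: "Factorial_Ring.prime q" "q dvd card (rcosets (centralizer_mod N U))"
      using index_gt_one[OF fin sD ne] prime_factor_nat[of "card (rcosets (centralizer_mod N U))"] by auto
    obtain Q where Q: "sylow_subgroup q Q" using sylow_subgroup_exists[OF fin q(1)] by blast
    then have QG: "Q \<lhd> G" using syl q by blast
    obtain b where b: "card Q = q ^ b" using Q by (auto simp: sylow_subgroup_def)
    have sQ: "subgroup Q G" using QG by (rule normal_imp_subgroup)
    have Qc: "Q \<subseteq> carrier G" using sQ by (rule subgroup.subset)
    have "N \<subseteq> centralizer_mod Q U"
    proof (cases "q = p")
      case True
      then have "Q \<subseteq> P" using normal_sylow_subgroup_contains[OF fin p(1) P PG sQ] b by blast
      then show ?thesis using NP by (auto simp: centralizer_mod_def)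
    next
      case False
      have "card (P \<inter> Q) dvd p ^ a" "card (P \<inter> Q) dvd q ^ b"
        using card_subgroup_dvd[OF fin subgroups_Inter_pair[OF sP sQ]] sP sQ a b by (metis Int_lower1 Int_lower2)+
      moreover have "coprime (p ^ a) (q ^ b)" using p q False by (simp add: primes_coprime)
      ultimately have "card (P \<inter> Q) = 1" by (metis coprime_common_divisor_nat nat_dvd_1_iff_1 dvd_refl)
      then obtain z where "P \<inter> Q = {z}" by (auto simp: card_1_singleton_iff)
      then have PQ: "P \<inter> Q = {\<one>}" using sP sQ by (auto dest: subgroup.one_closed)
      have "N \<inter> P \<subseteq> centralizer_mod Q U"
      proof
        fix x assume x: "x \<in> N \<inter> P"
        have "x \<otimes> y \<otimes> inv x \<otimes> inv y \<in> U" if y: "y \<in> Q" for y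
        proof -
          have c: "x \<in> carrier G" "y \<in> carrier G" using x y Pc Qc by auto
          have "x \<otimes> y \<otimes> inv x \<otimes> inv y \<in> Q"
            by (rule subgroup.m_closed[OF sQ normal_conj_closed(1)[OF QG c(1) y]])
              (use y sQ in \<open>auto simp: subgroup.m_inv_closed\<close>)
          moreover have "x \<otimes> (y \<otimes> inv x \<otimes> inv y) \<in> P"
            by (rule subgroup.m_closed[OF sP _ normal_conj_closed(1)[OF PG c(2)]])
              (use x sP in \<open>auto simp: subgroup.m_inv_closed\<close>)
          ultimately have "x \<otimes> y \<otimes> inv x \<otimes> inv y \<in> P \<inter> Q" using c by (simp add: m_assoc)
          then show ?thesis using PQ subgroup.one_closed[OF sU] by simp
        qed
        then show "x \<in> centralizer_mod Q U" using x Pc by (auto simp: centralizer_mod_def)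
      qed
      then have "U <#> (N \<inter> P) \<subseteq> centralizer_mod Q U"
        by (intro set_mult_least centralizer_mod_subgroup[OF U(1) Qc]
            normal_subset_centralizer_mod[OF U(1) Qc])
      then show ?thesis using NU by simp
    qed
    then have "Q \<subseteq> centralizer_mod N U"
      using centralizer_mod_commute[OF U(1) Qc Nc] by blast
    then have "card (rcosets (centralizer_mod N U)) dvd card (rcosets Q)"
      using index_dvd[OF fin sQ sD] by blast
    then show False using q(2) Q by (auto simp: sylow_subgroup_def)
  qed
  then have "N \<subseteq> centralizer_mod (carrier G) U"
    using centralizer_mod_commute[OF U(1) Nc, of "carrier G"] by simp
  then have "commutator_subgroup G N (carrier G) \<subseteq> U"
    using commutator_subgroup_le_iff[OF Nc sU] by blast
  then show ?thesis using U by blast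
qed

lemma nilpotent_of_maximal_normal:
  assumes fin: "finite (carrier G)" and max: "\<And>M. maximal_subgroup M G \<Longrightarrow> M \<lhd> G"
  shows "nilpotent_group G"
proof -
  have norm: "lower_central G i \<lhd> G" for i
    by (induction i) (auto simp: normal_self normal_imp_subgroup intro!: commutator_subgroup_normal)
  \<comment> \<open>A term of least order must be trivial, since a nontrivial term is followed by a
    strictly smaller one.\<close>
  obtain c where c: "\<And>i. card (lower_central G c) \<le> card (lower_central G i)"
    using ex_has_least_nat[of "\<lambda>_. True" 0 "\<lambda>i. card (lower_central G i)"] by auto
  have "lower_central G c = {\<one>}"
  proof (rule ccontr)
    assume "lower_central G c \<noteq> {\<one>}"
    then have "lower_central G (Suc c) \<subset> lower_central G c"
      using normal_commutator_proper[OF fin sylow_subgroup_normal[OF fin _ _ max] norm] by simp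
    then have "card (lower_central G (Suc c)) < card (lower_central G c)"
      using finite_subset[OF subgroup.subset[OF normal_imp_subgroup[OF norm]] fin]
      by (intro psubset_card_mono)
    then show False using c[of "Suc c"] by simp
  qed
  then show ?thesis unfolding nilpotent_group_def using group_axioms by blast
qed

end

section \<open>Groups with \<open>IC\<Phi>\<close> 2-maximal subgroups\<close>

locale two_maximal_IC_Phi_group = group +
  assumes fin: "finite (carrier G)"
    and nontrivial: "\<exists>M H. maximal_subgroup M G \<and> maximal_subgroup H (G\<lparr>carrier := M\<rparr>) \<and> H \<noteq> {\<one>}"
    and IC: "\<And>M H. maximal_subgroup M G \<Longrightarrow> maximal_subgroup H (G\<lparr>carrier := M\<rparr>) \<Longrightarrow> IC_Phi_subgroup H G"
begin

lemma two_maximal_normal_in: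
  assumes M: "maximal_subgroup M G" and H: "maximal_subgroup H (G\<lparr>carrier := M\<rparr>)"
  shows "H \<lhd> G\<lparr>carrier := M\<rparr>"
proof -
  have sM: "subgroup M G" using M by (simp add: maximal_subgroup_def)
  interpret M: group "G\<lparr>carrier := M\<rparr>" using sM by (rule subgroup_imp_group)
  show ?thesis
  proof (rule M.IC_Phi_maximal_normal[OF _ _ H])
    show "finite (carrier (G\<lparr>carrier := M\<rparr>))"
      using finite_subset[OF subgroup.subset[OF sM] fin] by simp
    fix L assume L: "maximal_subgroup L (G\<lparr>carrier := M\<rparr>)"
    then have "L \<subseteq> M" using maximal_subgroup_carrier_update_iff[OF sM] by blast
    then show "IC_Phi_subgroup L (G\<lparr>carrier := M\<rparr>)"
      using IC_Phi_subgroup_carrier_update[OF IC[OF M L] sM] by blast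
  qed
qed

text \<open>If \<open>N\<close> were not in \<open>M\<close>, a maximal subgroup above
  \<open>N\<close> would be normal: the maximal subgroups of \<open>M\<close> are normal in
  \<open>M\<close>, and G/N is a quotient of \<open>M\<close>.\<close>

lemma normal_le_maximal:
  assumes no: "\<And>M. maximal_subgroup M G \<Longrightarrow> \<not> M \<lhd> G"
    and N: "N \<lhd> G" "N \<noteq> carrier G" and M: "maximal_subgroup M G"
  shows "N \<subseteq> M"
proof (rule ccontr)
  assume not: "\<not> N \<subseteq> M"
  obtain K where K: "maximal_subgroup K G" "N \<subseteq> K"
    using maximal_subgroup_exists[OF fin normal_imp_subgroup[OF N(1)] N(2)] by blast
  have "K \<lhd> G"
    using maximal_subgroup_over_normal_is_normal[OF fin N(1) K M not two_maximal_normal_in[OF M]] .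
  then show False using no K by blast
qed

lemma two_maximal_eq_frattini:
  assumes no: "\<And>M. maximal_subgroup M G \<Longrightarrow> \<not> M \<lhd> G"
    and M: "maximal_subgroup M G" and H: "maximal_subgroup H (G\<lparr>carrier := M\<rparr>)"
  shows "H = frattini G"
proof -
  have sM: "subgroup M G" and MG: "M \<noteq> carrier G" using M by (auto simp: maximal_subgroup_def)
  have sH: "subgroup H G" and HM: "H \<subset> M"
    using H maximal_subgroup_carrier_update_iff[OF sM] by auto
  let ?R = "commutator_subgroup G H (carrier G)"
  have R: "?R \<lhd> G" using sH by (rule commutator_subgroup_normal)
  have sR: "subgroup ?R G" using R by (rule normal_imp_subgroup)
  have "H \<lhd> G"
  proof (cases "H = {\<one>}")
    case True
    then show ?thesis using one_is_normal by simp
  next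
    case False
    have "?R \<noteq> carrier G"
      using IC_Phi_not_le_commutator[OF fin IC[OF M H] False] subgroup.subset[OF sH] by blast
    then have RM: "?R \<subseteq> M" using normal_le_maximal[OF no R _ M] by blast
    \<comment> \<open>Otherwise RH = M with R = [H, G], so [M, G] \<le> R \<le> M and
      \<open>M\<close> would be normal.\<close>
    have "?R \<subseteq> H"
    proof (rule ccontr)
      assume "\<not> ?R \<subseteq> H"
      then have "?R <#> H = M" using maximal_subgroup_in_set_mult[OF R sM RM H] by blast
      then have "commutator_subgroup G M (carrier G) \<subseteq> M"
        using commutator_le_of_set_mult[OF sH] RM by auto
      then show False using normal_of_commutator_le[OF sM] no[OF M] by blast
    qed
    then show ?thesis using normal_of_commutator_le[OF sH] by blast
  qed
  moreover have "H \<noteq> carrier G" using HM subgroup.subset[OF sM] by blast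
  ultimately have HF: "H \<subseteq> frattini G"
    using normal_le_maximal[OF no] subgroup.subset[OF sH] by (auto simp: frattini_def)
  have "frattini G \<subseteq> M" using frattini_le_maximal[OF M] .
  \<comment> \<open>Now H \<le> \<Phi>(G) < M, and maximality of \<open>H\<close> in
    \<open>M\<close> gives equality.\<close>
  moreover have "frattini G \<noteq> M" using frattini_normal no[OF M] by auto
  ultimately show ?thesis
    using H HF frattini_subgroup maximal_subgroup_carrier_update_iff[OF sM] by blast
qed

lemma normal_maximal_exists: "\<exists>M. maximal_subgroup M G \<and> M \<lhd> G"
proof (rule ccontr)
  assume "\<nexists>M. maximal_subgroup M G \<and> M \<lhd> G"
  then have no: "\<And>M. maximal_subgroup M G \<Longrightarrow> \<not> M \<lhd> G" by blast
  let ?F = "frattini G"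
  have sF: "subgroup ?F G" by (rule frattini_subgroup)
  have pow: "\<exists>p n. Factorial_Ring.prime (p::nat) \<and> card M = p ^ n" if M: "maximal_subgroup M G" for M
  proof -
    have sM: "subgroup M G" using M by (simp add: maximal_subgroup_def)
    interpret M: group "G\<lparr>carrier := M\<rparr>" using sM by (rule subgroup_imp_group)
    have FM: "?F \<subset> M" using frattini_le_maximal[OF M] frattini_normal no[OF M] by auto
    have "H \<subseteq> ?F" if "subgroup H (G\<lparr>carrier := M\<rparr>)" "H \<noteq> M" for H
    proof -
      have "subgroup H G" "H \<subset> M" using that subgroup_carrier_update_iff[OF sM] by auto
      then show ?thesis
        using maximal_subgroup_in_exists[OF fin sM] two_maximal_eq_frattini[OF no M] by blast
    qed
    then show ?thesis
      using M.unique_maximal_imp_prime_power_order[of ?F] FM sF subgroup_carrier_update_iff[OF sM]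
        finite_subset[OF subgroup.subset[OF sM] fin] by (auto simp: order_def)
  qed
  obtain M0 H0 where M0: "maximal_subgroup M0 G"
    and H0: "maximal_subgroup H0 (G\<lparr>carrier := M0\<rparr>)" "H0 \<noteq> {\<one>}" using nontrivial by blast
  \<comment> \<open>The nontrivial 2-maximal subgroup enters here: it equals \<Phi>(G). Since
    \<Phi>(G) lies in every maximal subgroup, all of them are powers of the same prime q in
    order.\<close>
  have F1: "?F \<noteq> {\<one>}" using two_maximal_eq_frattini[OF no M0 H0(1)] H0(2) by simp
  have sM0: "subgroup M0 G" using M0 by (simp add: maximal_subgroup_def)
  obtain q n where q: "Factorial_Ring.prime (q::nat)" "card M0 = q ^ n" using pow[OF M0] by blast
  have "card ?F dvd q ^ n"
    using card_subgroup_dvd[OF fin sF sM0] frattini_le_maximal[OF M0] q by simp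
  then obtain k where k: "card ?F = q ^ k" using q by (auto simp: divides_primepow_nat)
  have "card ?F \<noteq> 1"
  proof
    assume "card ?F = 1"
    then obtain z where "?F = {z}" by (auto simp: card_1_singleton_iff)
    then show False using F1 subgroup.one_closed[OF sF] by simp
  qed
  then have qF: "q dvd card ?F" using k by (cases k) auto
  \<comment> \<open>A Sylow p-subgroup is either all of \<open>G\<close> or inside a maximal
    subgroup. Either way it lies in a group of prime power order that also contains \<Phi>(G), so p
    = q.\<close>
  have prime_eq: "p = q" if p: "Factorial_Ring.prime (p::nat)" "p dvd order G" for p
  proof -
    obtain P where P: "sylow_subgroup p P" using sylow_subgroup_exists[OF fin p(1)] by blast
    then have sP: "subgroup P G" by (simp add: sylow_subgroup_def)
    obtain a where a: "card P = p ^ a" using P by (auto simp: sylow_subgroup_def)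
    have ord: "card (rcosets P) * card P = order G" using lagrange_finite[OF fin sP] .
    have pP: "p dvd card P"
      using p P ord by (metis prime_dvd_mult_iff sylow_subgroup_def)
    show ?thesis
    proof (cases "P = carrier G")
      case True
      then have "q dvd p ^ a"
        using qF card_subgroup_dvd[OF fin sF subgroup_self frattini_subset] a by (metis dvd_trans)
      then show ?thesis using p q by (metis prime_dvd_power primes_dvd_imp_eq)
    next
      case False
      then obtain M where M: "maximal_subgroup M G" "P \<subseteq> M"
        using maximal_subgroup_exists[OF fin sP] by blast
      have sM: "subgroup M G" using M by (simp add: maximal_subgroup_def)
      obtain r m where r: "Factorial_Ring.prime (r::nat)" "card M = r ^ m" using pow[OF M(1)] by blast
      have "p dvd r ^ m" using pP card_subgroup_dvd[OF fin sP sM M(2)] r by (metis dvd_trans)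
      moreover have "q dvd r ^ m"
        using qF card_subgroup_dvd[OF fin sF sM frattini_le_maximal[OF M(1)]] r by (metis dvd_trans)
      ultimately show ?thesis using p q r by (metis prime_dvd_power primes_dvd_imp_eq)
    qed
  qed
  have "order G \<noteq> 0" using fin by (simp add: order_gt_0_iff_finite[symmetric])
  have "\<exists>n. order G = q ^ n"
  proof (rule ccontr)
    assume "\<nexists>n. order G = q ^ n"
    then have "\<not> (\<exists>n. normalize (order G) = q ^ n)" by simp
    from Ex_other_prime_factor[OF \<open>order G \<noteq> 0\<close> this q(1)] show False using prime_eq by blast
  qed
  then show False using p_group_maximal_normal[OF fin _ q(1) M0] no[OF M0] by blast
qed

lemma maximal_normal:
  assumes M: "maximal_subgroup M G"
  shows "M \<lhd> G"
proof (rule ccontr)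
  assume not: "\<not> M \<lhd> G"
  have sM: "subgroup M G" using M by (simp add: maximal_subgroup_def)
  have absorb: "A \<subseteq> M" if "subgroup A G" "commutator_subgroup G A (carrier G) \<subseteq> M" for A
    using maximal_subgroup_normal_or_le[OF fin M that] not by blast
  obtain K where K: "maximal_subgroup K G" and KG: "K \<lhd> G" using normal_maximal_exists by blast
  have sK: "subgroup K G" using K by (simp add: maximal_subgroup_def)
  have Kc: "K \<subseteq> carrier G" using sK by (rule subgroup.subset)
  have KM: "\<not> K \<subseteq> M" using K M KG not unfolding maximal_subgroup_def by blast
  have normal_le: "J \<subseteq> M" if J: "maximal_subgroup J (G\<lparr>carrier := K\<rparr>)" and JG: "J \<lhd> G" for J
    using absorb normal_IC_Phi_commutator_le[OF fin IC[OF K J] JG] frattini_le_maximal[OF M]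
      normal_imp_subgroup[OF JG] by blast
  \<comment> \<open>The argument of \<open>IC_Phi_maximal_normal\<close> repeated inside
    \<open>K\<close>, with commutators still taken in \<open>G\<close>: here [K, G] \<le> L \<le> M,
    and \<open>K\<close> would be absorbed by \<open>M\<close>.\<close>
  have J_normal: "J \<lhd> G" if J: "maximal_subgroup J (G\<lparr>carrier := K\<rparr>)" for J
  proof (rule ccontr)
    assume Jn: "\<not> J \<lhd> G"
    have sJ: "subgroup J G" and JK: "J \<subset> K"
      using J maximal_subgroup_carrier_update_iff[OF sK] by auto
    let ?R = "commutator_subgroup G J (carrier G)"
    have R: "?R \<lhd> G" using sJ by (rule commutator_subgroup_normal)
    have sR: "subgroup ?R G" using R by (rule normal_imp_subgroup)
    have RK: "?R \<subseteq> K"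
      using commutator_le_normal[OF KG] commutator_subgroup_mono[OF _ subset_refl, of J K] JK by blast
    have "\<not> ?R \<subseteq> J" using Jn normal_of_commutator_le[OF sJ] by blast
    then have "?R <#> J = K" using maximal_subgroup_in_set_mult[OF R sK RK J] by blast
    then have KR: "commutator_subgroup G K (carrier G) \<subseteq> ?R"
      using commutator_le_of_set_mult[OF sJ] by simp
    have "J \<noteq> {\<one>}" using Jn one_is_normal by blast
    then have "\<not> J \<subseteq> ?R" using IC_Phi_not_le_commutator[OF fin IC[OF K J]] by blast
    then have "?R \<subset> K" using RK JK by blast
    then obtain L where L: "maximal_subgroup L (G\<lparr>carrier := K\<rparr>)" "?R \<subseteq> L"
      using maximal_subgroup_in_exists[OF fin sK sR] by blast
    have sL: "subgroup L G" "L \<subset> K"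
      using L maximal_subgroup_carrier_update_iff[OF sK] by auto
    have "commutator_subgroup G L (carrier G) \<subseteq> L"
      using commutator_subgroup_mono[OF _ subset_refl, of L K] sL KR L(2) by blast
    then have "L \<lhd> G" using normal_of_commutator_le[OF sL(1)] by blast
    then have "L \<subseteq> M" using normal_le L by blast
    then show False using absorb[OF sK] KR L(2) KM by blast
  qed
  let ?J = "K \<inter> M"
  have sJ: "subgroup ?J G" using subgroups_Inter_pair[OF sK sM] .
  have JK: "?J \<subset> K" using KM by blast
  \<comment> \<open>Every maximal subgroup of \<open>K\<close> is normal in \<open>G\<close> and so
    lies in \<open>M\<close>; hence K \<inter> M contains every proper subgroup of
    \<open>K\<close>.\<close>
  have le_J: "H \<subseteq> ?J" if H: "subgroup H G" "H \<subset> K" for H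
  proof -
    obtain L where L: "maximal_subgroup L (G\<lparr>carrier := K\<rparr>)" "H \<subseteq> L"
      using maximal_subgroup_in_exists[OF fin sK H] by blast
    then have "L \<subseteq> M" using normal_le J_normal by blast
    then show ?thesis using L(2) H(2) by blast
  qed
  have J: "maximal_subgroup ?J (G\<lparr>carrier := K\<rparr>)"
    unfolding maximal_subgroup_carrier_update_iff[OF sK] using sJ JK le_J by blast
  have JG: "?J \<lhd> G" using J_normal J by blast
  show False
  proof (cases "?J = {\<one>}")
    \<comment> \<open>Now \<open>K\<close> has no proper nontrivial subgroup. A nontrivial
      \<open>H\<close> below \<open>L\<close> gives KH = G and L \<inter> K = 1, and the modular law
      then forces L = H.\<close>
    case True
    obtain L H where L: "maximal_subgroup L G"
      and H: "maximal_subgroup H (G\<lparr>carrier := L\<rparr>)" "H \<noteq> {\<one>}" using nontrivial by blast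
    have sL: "subgroup L G" using L by (simp add: maximal_subgroup_def)
    have sH: "subgroup H G" "H \<subset> L" using H maximal_subgroup_carrier_update_iff[OF sL] by auto
    have "\<not> H \<subseteq> {\<one>}" using H(2) subgroup.one_closed[OF sH(1)] by blast
    then have HK: "\<not> H \<subset> K" using le_J[OF sH(1)] True by blast
    have LK: "L \<inter> K \<subseteq> {\<one>}"
    proof -
      have "L \<noteq> K" using HK sH by blast
      then have "\<not> K \<subseteq> L" using K L unfolding maximal_subgroup_def by blast
      then have "L \<inter> K \<subset> K" by blast
      then show ?thesis using le_J[OF subgroups_Inter_pair[OF sL sK]] True by blast
    qed
    have "\<not> H \<subseteq> K" using LK \<open>\<not> H \<subseteq> {\<one>}\<close> sH by blast
    have sKH: "subgroup (K <#> H) G" using mult_norm_subgroup[OF KG sH(1)] .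
    have "K <#> H = carrier G"
      using K sKH subset_set_mult[OF sK sH(1)] \<open>\<not> H \<subseteq> K\<close> unfolding maximal_subgroup_def by blast
    have "L \<subseteq> H"
    proof
      fix l assume l: "l \<in> L"
      then have lc: "l \<in> carrier G" using sL by (simp add: subgroup.mem_carrier)
      then have "l \<in> K <#> H" using \<open>K <#> H = carrier G\<close> by simp
      then obtain k h where kh: "k \<in> K" "h \<in> H" "l = k \<otimes> h" by (auto simp: set_mult_def)
      have c: "k \<in> carrier G" "h \<in> carrier G" using kh Kc sH by (auto simp: subgroup.mem_carrier)
      have "h \<in> L" using kh sH by blast
      then have "l \<otimes> inv h \<in> L"
        using l subgroup.m_closed[OF sL] subgroup.m_inv_closed[OF sL] by blast
      then have "k \<in> L" using kh c by (simp add: word_simps)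
      then have "k = \<one>" using LK kh by blast
      then show "l \<in> H" using kh c by simp
    qed
    then show False using sH by blast
  next
    case False
    have cover: "H = K" if "subgroup H G" "H \<subseteq> K" "x \<in> H" "x \<notin> M" for H x
      using le_J[of H] that by blast
    obtain x where x: "x \<in> K" "x \<notin> M" using KM by blast
    \<comment> \<open>By \<open>cover\<close>, the centralizer of x in \<open>K\<close> is
      \<open>K\<close>; then the center of \<open>K\<close> contains x, so it is \<open>K\<close>
      too.\<close>
    have comm: "u \<otimes> v = v \<otimes> u" if u: "u \<in> K" and v: "v \<in> K" for u v
    proof -
      have one: "{\<one>} \<lhd> G" by (rule one_is_normal)
      have triv: "a \<otimes> b \<otimes> inv a \<otimes> inv b = \<one> \<longleftrightarrow> a \<otimes> b = b \<otimes> a" if "a \<in> carrier G" "b \<in> carrier G" for a b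
        using inv_solve_right'[of \<one> "a \<otimes> b" "b \<otimes> a"] that by (auto simp: inv_mult_group m_assoc)
      have "K \<inter> centralizer_mod {x} {\<one>} = K"
      proof (rule cover[of _ x])
        show "subgroup (K \<inter> centralizer_mod {x} {\<one>}) G"
          using x Kc by (intro subgroups_Inter_pair[OF sK] centralizer_mod_subgroup[OF one]) auto
        show "x \<in> K \<inter> centralizer_mod {x} {\<one>}"
          using x Kc by (auto simp: centralizer_mod_def triv)
      qed (use x in auto)
      then have "K \<subseteq> centralizer_mod {x} {\<one>}" by blast
      then have "x \<in> centralizer_mod K {\<one>}"
        using centralizer_mod_commute[OF one _ Kc, of "{x}"] x Kc by auto
      then have "K \<inter> centralizer_mod K {\<one>} = K"
        by (intro cover[of _ x])
          (use x in \<open>auto intro!: subgroups_Inter_pair[OF sK] centralizer_mod_subgroup[OF one Kc]\<close>)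
      then have "u \<in> centralizer_mod K {\<one>}" using u by blast
      then show ?thesis using triv u v Kc by (auto simp: centralizer_mod_def)
    qed
    have "commutator_subgroup G K (carrier G) \<subseteq> ?J"
      unfolding commutator_subgroup_le_iff[OF Kc sJ]
    proof
      fix y assume y: "y \<in> K"
      then have yc: "y \<in> carrier G" using Kc by blast
      have "y \<otimes> g \<otimes> inv y \<otimes> inv g \<in> ?J" if g: "g \<in> carrier G" for g
      proof (rule ccontr)
        assume notJ: "y \<otimes> g \<otimes> inv y \<otimes> inv g \<notin> ?J"
        \<comment> \<open>\<open>K\<close> being abelian makes \<open>f\<close> an endomorphism of \<open>K\<close>.\<close>
        define f where "f u = u \<otimes> g \<otimes> inv u \<otimes> inv g" for u
        have conjK: "g \<otimes> inv u \<otimes> inv g \<in> K" if "u \<in> K" for u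
          using normal_conj_closed(1)[OF KG g subgroup.m_inv_closed[OF sK that]] .
        have fK: "f u \<in> K" if "u \<in> K" for u
          using subgroup.m_closed[OF sK that conjK[OF that]] that g Kc
          by (auto simp: f_def m_assoc subset_iff)
        have f_mult: "f (u \<otimes> v) = f u \<otimes> f v" if uv: "u \<in> K" "v \<in> K" for u v
        proof -
          have c: "u \<in> carrier G" "v \<in> carrier G" using uv Kc by auto
          have "f (u \<otimes> v) = u \<otimes> (f v \<otimes> (g \<otimes> inv u \<otimes> inv g))"
            using c g by (simp add: f_def word_simps)
          also have "f v \<otimes> (g \<otimes> inv u \<otimes> inv g) = (g \<otimes> inv u \<otimes> inv g) \<otimes> f v"
            using comm[OF fK[OF uv(2)] conjK[OF uv(1)]] .
          also have "u \<otimes> ((g \<otimes> inv u \<otimes> inv g) \<otimes> f v) = f u \<otimes> f v"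
            using c g by (simp add: f_def word_simps)
          finally show ?thesis .
        qed
        interpret KK: group "G\<lparr>carrier := K\<rparr>" using sK by (rule subgroup_imp_group)
        have hom: "f \<in> hom (G\<lparr>carrier := K\<rparr>) (G\<lparr>carrier := K\<rparr>)"
          by (rule homI) (use fK f_mult in auto)
        interpret f: group_hom "G\<lparr>carrier := K\<rparr>" "G\<lparr>carrier := K\<rparr>" f
          by unfold_locales (rule hom)
        have "subgroup (f ` K) (G\<lparr>carrier := K\<rparr>)" using f.img_is_subgroup by simp
        then have "subgroup (f ` K) G" "f ` K \<subseteq> K" using subgroup_carrier_update_iff[OF sK] by auto
        moreover have "f y \<in> f ` K" "f y \<notin> M" using y notJ fK[OF y] by (auto simp: f_def)
        \<comment> \<open>The image of \<open>f\<close> contains f y, which lies in \<open>K\<close>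
          but not in \<open>M\<close>, so \<open>cover\<close> applies. By finiteness
          \<open>f\<close> is injective and so maps K \<inter> M onto itself, with values in
          [K \<inter> M, G].\<close>
        ultimately have fKK: "f ` K = K" using cover by blast
        have finK: "finite K" using finite_subset[OF Kc fin] .
        have inj: "inj_on f K" using fKK finK by (simp add: eq_card_imp_inj_on)
        have fR: "f u \<in> commutator_subgroup G ?J (carrier G)" if "u \<in> ?J" for u
          using that g unfolding commutator_subgroup_def f_def by (intro generate.incl) blast
        then have fJ: "f ` ?J \<subseteq> ?J" using commutator_le_normal[OF JG] by blast
        have surj: "f ` ?J = ?J"
          using endo_inj_surj[OF _ fJ inj_on_subset[OF inj]] finK by blast
        have "f ` ?J \<subseteq> commutator_subgroup G ?J (carrier G)" by (rule image_subsetI) (rule fR)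
        then have "?J \<subseteq> commutator_subgroup G ?J (carrier G)" unfolding surj .
        then show False using IC_Phi_not_le_commutator[OF fin IC[OF K J] False] by blast
      qed
      then show "y \<in> centralizer_mod (carrier G) ?J" using yc by (simp add: centralizer_mod_def)
    qed
    then show False using absorb[OF sK] KM by blast
  qed
qed

end

theorem theorem1p8:
  fixes G :: "('a, 'b) monoid_scheme"
  assumes "group G"
    and "finite (carrier G)"
    and "\<exists>H. n_maximal_subgroup 2 H G \<and> H \<noteq> {\<one>\<^bsub>G\<^esub>}"
    and "\<And>H. n_maximal_subgroup 2 H G \<Longrightarrow> IC_Phi_subgroup H G"
  shows "nilpotent_group G"
proof -
  interpret group G by fact
  interpret two_maximal_IC_Phi_group G
    by unfold_locales (use assms two_maximal_subgroup_iff[OF assms(1)] in blast)+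
  show ?thesis using nilpotent_of_maximal_normal[OF fin maximal_normal] .
qed

end
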